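(* Let $m,n$ be distinct positive integers with $m<n$, and let $d=\gcd(m,n)$. Then $\mathrm{PGL}(m,n)$ is a split 2-group. In particular, it is classified by its homotopy groups: $$\pi_1\mathrm{PGL}(m,n)\cong\begin{cases}\mathbb{C}^*&\text{if } m\nmid n,\\ \mathbb{C}^*\ltimes\mathbb{C}&\text{if } m\mid n,\end{cases}\qquad \pi_2\mathrm{PGL}(m,n)\cong\mathbb{Z}_d.$$ In the case $m\mid n$, the action of $\mathbb{C}^*$ on $\mathbb{C}$ in the semi-direct product $\mathbb{C}^*\ltimes\mathbb{C}$ is the multiplication action.
   Context: A crossed-module $[\varphi:G_2\to G_1]$ is a group homomorphism with a right action of $G_1$ on $G_2$ that lifts the conjugation action of $G_1$ on the image of $\varphi$ and restricts along $\varphi$ to the conjugation action of $G_2$ on itself. Crossed-modules are equivalent to (strict) 2-groups, and the two terms are used synonymously. For $\mathfrak{G}=[\varphi:G_2\to G_1]$ one has $\pi_1\mathfrak{G}=\mathrm{coker}\,\varphi$ and $\pi_2\mathfrak{G}=\ker\varphi$. A 2-group $[G_2\to G_1]$ is called split if the projection $G_1\to\pi_1\mathfrak{G}$ admits a section that is a group homomorphism. $\mathrm{PGL}(m,n)$ is the 2-group associated to the crossed-module $[\varphi:\mathbb{C}^*\to G_{m,n}]$, where $G_{m,n}$ is the group of algebraic automorphisms of $\mathbb{C}^2\setminus\{0\}$ that are equivariant for the $\mathbb{C}^*$-action $t\cdot(x,y)=(t^mx,t^ny)$, $\varphi(\lambda)$ is the action of $\lambda$, and $G_{m,n}$ acts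 trivially on $\mathbb{C}^*$. *)

theory Defs
  imports
    Complex_Main
    "HOL-Algebra.Bij"
    "HOL-Algebra.Coset"
    "HOL-Algebra.Elementary_Groups"
    "HOL-Computational_Algebra.Polynomial"
begin

section \<open>Crossed modules\<close>

text \<open>
  The data of a crossed module \<open>[bd : grp2 \<rightarrow> grp1]\<close>; \<open>act X x g\<close> is the right action
  \<open>x\<^sup>g\<close> of \<open>g\<close> in \<open>grp1 X\<close> on \<open>x\<close> in \<open>grp2 X\<close>.
\<close>

record ('a, 'b) xmod =
  grp1 :: "'a monoid"
  grp2 :: "'b monoid"
  bd :: "'b \<Rightarrow> 'a"
  act :: "'b \<Rightarrow> 'a \<Rightarrow> 'b"

definition crossed_module :: "('a, 'b) xmod \<Rightarrow> bool" where
  "crossed_module X \<longleftrightarrow>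
     group (grp1 X) \<and> group (grp2 X) \<and> bd X \<in> hom (grp2 X) (grp1 X) \<and>
     (\<forall>g\<in>carrier (grp1 X). (\<lambda>x. act X x g) \<in> hom (grp2 X) (grp2 X)) \<and>
     (\<forall>x\<in>carrier (grp2 X). act X x \<one>\<^bsub>grp1 X\<^esub> = x) \<and>
     (\<forall>x\<in>carrier (grp2 X). \<forall>g\<in>carrier (grp1 X). \<forall>h\<in>carrier (grp1 X).
        act X x (g \<otimes>\<^bsub>grp1 X\<^esub> h) = act X (act X x g) h) \<and>
     (\<forall>x\<in>carrier (grp2 X). \<forall>g\<in>carrier (grp1 X).
        bd X (act X x g) = inv\<^bsub>grp1 X\<^esub> g \<otimes>\<^bsub>grp1 X\<^esub> bd X x \<otimes>\<^bsub>grp1 X\<^esub> g) \<and>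
     (\<forall>x\<in>carrier (grp2 X). \<forall>y\<in>carrier (grp2 X).
        act X x (bd X y) = inv\<^bsub>grp2 X\<^esub> y \<otimes>\<^bsub>grp2 X\<^esub> x \<otimes>\<^bsub>grp2 X\<^esub> y)"

definition pi1 :: "('a, 'b) xmod \<Rightarrow> 'a set monoid" where
  "pi1 X = grp1 X Mod (bd X ` carrier (grp2 X))"

definition pi2 :: "('a, 'b) xmod \<Rightarrow> 'b monoid" where
  "pi2 X = (grp2 X)\<lparr>carrier := kernel (grp2 X) (grp1 X) (bd X)\<rparr>"

definition proj1 :: "('a, 'b) xmod \<Rightarrow> 'a \<Rightarrow> 'a set" where
  "proj1 X g = (bd X ` carrier (grp2 X)) #>\<^bsub>grp1 X\<^esub> g"

text \<open>
  The right action of \<open>\<pi>\<^sub>1\<close> on \<open>\<pi>\<^sub>2\<close>.  All representatives \<open>g\<close> of a class \<open>C\<close> give the same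
  \<open>x\<^sup>g\<close> when \<open>x\<close> lies in \<open>\<pi>\<^sub>2\<close>, which is central in \<open>grp2 X\<close>.
\<close>

definition pi_act :: "('a, 'b) xmod \<Rightarrow> 'b \<Rightarrow> 'a set \<Rightarrow> 'b" where
  "pi_act X x C = the_elem (act X x ` C)"

definition split_2group :: "('a, 'b) xmod \<Rightarrow> bool" where
  "split_2group X \<longleftrightarrow> crossed_module X \<and>
     (\<exists>s \<in> hom (pi1 X) (grp1 X). \<forall>C\<in>carrier (pi1 X). proj1 X (s C) = C)"

definition xmod_morphism ::
  "('a, 'b) xmod \<Rightarrow> ('c, 'd) xmod \<Rightarrow> ('a \<Rightarrow> 'c) \<Rightarrow> ('b \<Rightarrow> 'd) \<Rightarrow> bool" where
  "xmod_morphism X Y f1 f2 \<longleftrightarrow>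
     f1 \<in> hom (grp1 X) (grp1 Y) \<and> f2 \<in> hom (grp2 X) (grp2 Y) \<and>
     (\<forall>x\<in>carrier (grp2 X). f1 (bd X x) = bd Y (f2 x)) \<and>
     (\<forall>x\<in>carrier (grp2 X). \<forall>g\<in>carrier (grp1 X). f2 (act X x g) = act Y (f2 x) (f1 g))"

text \<open>
  A weak equivalence is a morphism that induces isomorphisms on \<open>\<pi>\<^sub>1\<close> and \<open>\<pi>\<^sub>2\<close>; the map \<open>h\<close>
  below is the induced map on \<open>\<pi>\<^sub>1\<close>.
\<close>

definition weak_equivalence ::
  "('a, 'b) xmod \<Rightarrow> ('c, 'd) xmod \<Rightarrow> ('a \<Rightarrow> 'c) \<Rightarrow> ('b \<Rightarrow> 'd) \<Rightarrow> bool" where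
  "weak_equivalence X Y f1 f2 \<longleftrightarrow> xmod_morphism X Y f1 f2 \<and>
     (\<exists>h \<in> iso (pi1 X) (pi1 Y). \<forall>g\<in>carrier (grp1 X). h (proj1 X g) = proj1 Y (f1 g)) \<and>
     f2 \<in> iso (pi2 X) (pi2 Y)"

text \<open>
  Equivalence of 2-groups, i.e. isomorphism after inverting weak equivalences.  A zigzag of weak
  equivalences from \<open>X\<close> to \<open>Y\<close> can be replaced by a butterfly, that is, by a span
  \<open>X \<leftarrow> [grp2 X \<times> grp2 Y \<rightarrow> E] \<rightarrow> Y\<close> in which \<open>E\<close> is an extension of \<open>grp1 X\<close> by \<open>grp2 Y\<close>.
  As a set such an \<open>E\<close> is \<open>grp1 X \<times> grp2 Y\<close>, so the types chosen for the apex \<open>K\<close> are no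
  restriction.
\<close>

definition equivalent_2groups :: "('a, 'b) xmod \<Rightarrow> ('c, 'd) xmod \<Rightarrow> bool" where
  "equivalent_2groups X Y \<longleftrightarrow>
     (\<exists>(K :: ('a \<times> 'd, 'b \<times> 'd) xmod) f1 f2 g1 g2.
        crossed_module K \<and> weak_equivalence K X f1 f2 \<and> weak_equivalence K Y g1 g2)"

text \<open>The homotopy groups agree, \<open>\<pi>\<^sub>2\<close> being regarded as a \<open>\<pi>\<^sub>1\<close>-module.\<close>

definition same_homotopy_groups :: "('a, 'b) xmod \<Rightarrow> ('c, 'd) xmod \<Rightarrow> bool" where
  "same_homotopy_groups X Y \<longleftrightarrow>
     (\<exists>\<alpha> \<in> iso (pi1 X) (pi1 Y). \<exists>\<beta> \<in> iso (pi2 X) (pi2 Y).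
        \<forall>x\<in>carrier (pi2 X). \<forall>C\<in>carrier (pi1 X). \<beta> (pi_act X x C) = pi_act Y (\<beta> x) (\<alpha> C))"


section \<open>Regular maps of open subsets of the affine plane\<close>

definition eval2 :: "complex poly poly \<Rightarrow> complex \<times> complex \<Rightarrow> complex" where
  "eval2 P p = poly (poly P [:snd p:]) (fst p)"

definition zariski_open :: "(complex \<times> complex) set \<Rightarrow> bool" where
  "zariski_open U \<longleftrightarrow> (\<exists>S. U = {p. \<exists>P\<in>S. eval2 P p \<noteq> 0})"

definition regular_function_on ::
  "(complex \<times> complex) set \<Rightarrow> (complex \<times> complex \<Rightarrow> complex) \<Rightarrow> bool" where
  "regular_function_on X h \<longleftrightarrow>
     (\<forall>p\<in>X. \<exists>U P Q. zariski_open U \<and> p \<in> U \<and> U \<subseteq> X \<and>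
        (\<forall>q\<in>U. eval2 Q q \<noteq> 0 \<and> h q = eval2 P q / eval2 Q q))"

definition regular_self_map ::
  "(complex \<times> complex) set \<Rightarrow> (complex \<times> complex \<Rightarrow> complex \<times> complex) \<Rightarrow> bool" where
  "regular_self_map X f \<longleftrightarrow> f \<in> X \<rightarrow> X \<and>
     regular_function_on X (\<lambda>p. fst (f p)) \<and> regular_function_on X (\<lambda>p. snd (f p))"


section \<open>The 2-group PGL(m,n)\<close>

definition Cstar :: "complex monoid" where
  "Cstar = \<lparr>carrier = UNIV - {0}, monoid.mult = (*), one = 1\<rparr>"

definition Cplus :: "complex monoid" where
  "Cplus = \<lparr>carrier = UNIV, monoid.mult = (+), one = 0\<rparr>"

definition punctured_plane :: "(complex \<times> complex) set" where
  "punctured_plane = UNIV - {(0, 0)}"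

definition weighted_action ::
  "nat \<Rightarrow> nat \<Rightarrow> complex \<Rightarrow> complex \<times> complex \<Rightarrow> complex \<times> complex" where
  "weighted_action m n t p = (t ^ m * fst p, t ^ n * snd p)"

definition equivariant_automorphisms ::
  "nat \<Rightarrow> nat \<Rightarrow> (complex \<times> complex \<Rightarrow> complex \<times> complex) set" where
  "equivariant_automorphisms m n =
     {f \<in> Bij punctured_plane.
        regular_self_map punctured_plane f \<and>
        regular_self_map punctured_plane (inv_into punctured_plane f) \<and>
        (\<forall>t\<in>carrier Cstar. \<forall>p\<in>punctured_plane.
           f (weighted_action m n t p) = weighted_action m n t (f p))}"

definition G_group :: "nat \<Rightarrow> nat \<Rightarrow> (complex \<times> complex \<Rightarrow> complex \<times> complex) monoid" where
  "G_group m n = (BijGroup punctured_plane)\<lparr>carrier := equivariant_automorphisms m n\<rparr>"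

definition PGL :: "nat \<Rightarrow> nat \<Rightarrow> (complex \<times> complex \<Rightarrow> complex \<times> complex, complex) xmod" where
  "PGL m n =
     \<lparr>grp1 = G_group m n, grp2 = Cstar,
      bd = (\<lambda>t. restrict (weighted_action m n t) punctured_plane),
      act = (\<lambda>x g. x)\<rparr>"

text \<open>\<open>semidirect K N \<theta>\<close> is \<open>K \<ltimes> N\<close> for the left action \<open>\<theta>\<close> of \<open>K\<close> on \<open>N\<close>.\<close>

definition semidirect :: "'k monoid \<Rightarrow> 'n monoid \<Rightarrow> ('k \<Rightarrow> 'n \<Rightarrow> 'n) \<Rightarrow> ('k \<times> 'n) monoid" where
  "semidirect K N \<theta> =
     \<lparr>carrier = carrier K \<times> carrier N,
      monoid.mult = (\<lambda>(k, x) (l, y). (k \<otimes>\<^bsub>K\<^esub> l, x \<otimes>\<^bsub>N\<^esub> \<theta> k y)),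
      one = (\<one>\<^bsub>K\<^esub>, \<one>\<^bsub>N\<^esub>)\<rparr>"

end

theory Submission
  imports Defs "HOL-Computational_Algebra.Fundamental_Theorem_Algebra"
begin

text \<open>
  Put \<open>k = n div m\<close>.  The equivariant automorphisms of the punctured plane are the triangular maps
  \<open>(x, y) \<mapsto> (a x, b y + c x^k)\<close> with \<open>a\<close> and \<open>b\<close> nonzero, where \<open>c = 0\<close> unless \<open>m\<close> divides \<open>n\<close>
  (\<open>equivariant_automorphisms_eq\<close>).  Indeed the components of an equivariant map are regular functions
  \<open>h\<close> with \<open>h (t^m x, t^n y) = t^w h (x, y)\<close>, the weight \<open>w\<close> being \<open>m\<close> or \<open>n\<close>.  On the lines \<open>y = 1\<close>
  and \<open>x = 1\<close> a regular function is a polynomial \<open>p\<close> respectively \<open>q\<close> in one variable, because its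
  reduced denominator has no zeros (\<open>locally_rational_imp_polynomial\<close>).  Homogeneity yields
  \<open>q (u^n) = u^w p (1 / u^m)\<close>, and a comparison of degrees leaves only multiples of \<open>x\<close> for
  \<open>w = m\<close>, and combinations of \<open>y\<close> and \<open>x^k\<close> for \<open>w = n\<close>.

  Dividing this group by the image \<open>t \<mapsto> (t^m x, t^n y)\<close> of \<open>Cstar\<close> computes \<open>\<pi>\<^sub>1\<close>.  In both cases
  there is an explicit surjection onto the claimed group with the right kernel and with a right
  inverse, which gives the splitting at the same time (\<open>split_2group_of_split_epi\<close>).  The group \<open>\<pi>\<^sub>2\<close>
  consists of the common \<open>m\<close>-th and \<open>n\<close>-th roots of unity, that is, of the \<open>d\<close>-th roots of unity.

  That split 2-groups are classified by their homotopy groups holds for all of them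
  (\<open>split_2groups_equivalent_iff\<close>).  A weak equivalence always preserves \<open>\<pi>\<^sub>1\<close>, \<open>\<pi>\<^sub>2\<close> and the action.
  Conversely a section \<open>s\<close> of the projection of \<open>X\<close> onto \<open>\<pi>\<^sub>1\<close> and the inclusion of \<open>\<pi>\<^sub>2\<close> form a weak
  equivalence to \<open>X\<close> from the crossed module \<open>[\<pi>\<^sub>2 \<rightarrow> \<pi>\<^sub>1]\<close> with trivial boundary; so two split
  2-groups with the same homotopy groups receive weak equivalences from a common one.
\<close>

section \<open>Crossed modules and their homotopy groups\<close>

lemma crossed_moduleD:
  assumes "crossed_module X"
  shows "group (grp1 X)" "group (grp2 X)" "group_hom (grp2 X) (grp1 X) (bd X)"
    and "g \<in> carrier (grp1 X) \<Longrightarrow> (\<lambda>x. act X x g) \<in> hom (grp2 X) (grp2 X)"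
    and "x \<in> carrier (grp2 X) \<Longrightarrow> act X x \<one>\<^bsub>grp1 X\<^esub> = x"
    and "\<lbrakk>x \<in> carrier (grp2 X); g \<in> carrier (grp1 X); h \<in> carrier (grp1 X)\<rbrakk>
      \<Longrightarrow> act X x (g \<otimes>\<^bsub>grp1 X\<^esub> h) = act X (act X x g) h"
    and "\<lbrakk>x \<in> carrier (grp2 X); g \<in> carrier (grp1 X)\<rbrakk>
      \<Longrightarrow> bd X (act X x g) = inv\<^bsub>grp1 X\<^esub> g \<otimes>\<^bsub>grp1 X\<^esub> bd X x \<otimes>\<^bsub>grp1 X\<^esub> g"
    and "\<lbrakk>x \<in> carrier (grp2 X); y \<in> carrier (grp2 X)\<rbrakk>
      \<Longrightarrow> act X x (bd X y) = inv\<^bsub>grp2 X\<^esub> y \<otimes>\<^bsub>grp2 X\<^esub> x \<otimes>\<^bsub>grp2 X\<^esub> y"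
  using assms by (auto simp: crossed_module_def group_hom_def group_hom_axioms_def)

lemma act_closed:
  assumes "crossed_module X" "x \<in> carrier (grp2 X)" "g \<in> carrier (grp1 X)"
  shows "act X x g \<in> carrier (grp2 X)"
  using crossed_moduleD(4)[OF assms(1,3)] assms(2) by (auto simp: hom_def)

text \<open>The conjugate of \<open>bd x\<close> by \<open>g\<close> is \<open>bd\<close> of the translate of \<open>x\<close> by \<open>g\<close> inverse.\<close>

lemma boundary_image_normal:
  assumes "crossed_module X"
  shows "(bd X ` carrier (grp2 X)) \<lhd> grp1 X"
proof -
  interpret A: group "grp1 X" by (rule crossed_moduleD(1)[OF assms])
  interpret b: group_hom "grp2 X" "grp1 X" "bd X" by (rule crossed_moduleD(3)[OF assms])
  show ?thesis
  proof (rule A.normal_invI)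
    show "subgroup (bd X ` carrier (grp2 X)) (grp1 X)" by (rule b.img_is_subgroup)
    fix g y assume g: "g \<in> carrier (grp1 X)" and "y \<in> bd X ` carrier (grp2 X)"
    then obtain x where x: "x \<in> carrier (grp2 X)" "y = bd X x" by auto
    have "bd X (act X x (inv\<^bsub>grp1 X\<^esub> g)) = g \<otimes>\<^bsub>grp1 X\<^esub> y \<otimes>\<^bsub>grp1 X\<^esub> inv\<^bsub>grp1 X\<^esub> g"
      using crossed_moduleD(7)[OF assms x(1), of "inv\<^bsub>grp1 X\<^esub> g"] g x(2) by simp
    then show "g \<otimes>\<^bsub>grp1 X\<^esub> y \<otimes>\<^bsub>grp1 X\<^esub> inv\<^bsub>grp1 X\<^esub> g \<in> bd X ` carrier (grp2 X)"
      using act_closed[OF assms x(1), of "inv\<^bsub>grp1 X\<^esub> g"] g by (metis A.inv_closed imageI)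
  qed
qed

lemma group_pi1: "crossed_module X \<Longrightarrow> group (pi1 X)"
  unfolding pi1_def by (rule normal.factorgroup_is_group[OF boundary_image_normal])

lemma proj1_hom: "crossed_module X \<Longrightarrow> proj1 X \<in> hom (grp1 X) (pi1 X)"
  unfolding pi1_def proj1_def using normal.r_coset_hom_Mod[OF boundary_image_normal] by simp

lemma carrier_pi1: "carrier (pi1 X) = proj1 X ` carrier (grp1 X)"
  by (simp add: pi1_def proj1_def carrier_FactGroup)

lemma proj1_eq_one_iff:
  assumes "crossed_module X" "g \<in> carrier (grp1 X)"
  shows "proj1 X g = \<one>\<^bsub>pi1 X\<^esub> \<longleftrightarrow> g \<in> bd X ` carrier (grp2 X)"
proof -
  interpret A: group "grp1 X" by (rule crossed_moduleD(1)[OF assms(1)])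
  have "subgroup (bd X ` carrier (grp2 X)) (grp1 X)"
    by (rule normal_imp_subgroup[OF boundary_image_normal[OF assms(1)]])
  then show ?thesis
    unfolding pi1_def proj1_def one_FactGroup
    by (meson A.coset_join1 A.coset_join2 assms(2))
qed

text \<open>
  The first isomorphism theorem, in the form in which \<open>\<pi>\<^sub>1\<close> is computed: a surjection from
  \<open>grp1 X\<close> whose kernel is the image of the boundary map exhibits its codomain as \<open>\<pi>\<^sub>1\<close>.
\<close>

lemma pi1_iso_of_epi:
  assumes X: "crossed_module X" and Q: "group Q" and q: "q \<in> hom (grp1 X) Q"
    and surj: "q ` carrier (grp1 X) = carrier Q"
    and ker: "kernel (grp1 X) Q q = bd X ` carrier (grp2 X)"
  shows "\<exists>h \<in> iso (pi1 X) Q. \<forall>g\<in>carrier (grp1 X). h (proj1 X g) = q g"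
proof -
  interpret q: group_hom "grp1 X" Q q
    using crossed_moduleD(1)[OF X] Q q by (simp add: group_hom_def group_hom_axioms_def)
  let ?h = "\<lambda>C. the_elem (q ` C)"
  have "?h \<in> iso (pi1 X) Q"
    using q.FactGroup_iso_set[OF surj] unfolding ker pi1_def .
  moreover have "?h (proj1 X g) = q g" if g: "g \<in> carrier (grp1 X)" for g
  proof -
    have "g \<in> proj1 X g"
      unfolding proj1_def ker[symmetric] by (rule q.G.rcos_self[OF g q.subgroup_kernel])
    moreover have "q y = q g" if y: "y \<in> proj1 X g" for y
    proof -
      obtain k where "k \<in> kernel (grp1 X) Q q" "y = k \<otimes>\<^bsub>grp1 X\<^esub> g"
        using y unfolding proj1_def ker[symmetric] r_coset_def by blast
      then show ?thesis using g by (simp add: kernel_def)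
    qed
    ultimately have "q ` proj1 X g = {q g}" by blast
    then show ?thesis by simp
  qed
  ultimately show ?thesis by (intro bexI[of _ ?h] ballI)
qed

lemma carrier_pi2: "carrier (pi2 X) = {x \<in> carrier (grp2 X). bd X x = \<one>\<^bsub>grp1 X\<^esub>}"
  by (simp add: pi2_def kernel_def)

lemma group_pi2:
  assumes "crossed_module X" shows "group (pi2 X)"
proof -
  interpret b: group_hom "grp2 X" "grp1 X" "bd X" by (rule crossed_moduleD(3)[OF assms])
  show ?thesis
    unfolding pi2_def by (rule b.subgroup_kernel[THEN subgroup.subgroup_is_group], rule crossed_moduleD(2)[OF assms])
qed

text \<open>
  An element \<open>x\<close> of \<open>\<pi>\<^sub>2\<close> has trivial boundary, so the conjugation by \<open>x\<close>, being the action of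
  that boundary, is trivial.
\<close>

lemma pi2_central:
  assumes X: "crossed_module X" and x: "x \<in> carrier (pi2 X)" and y: "y \<in> carrier (grp2 X)"
  shows "x \<otimes>\<^bsub>grp2 X\<^esub> y = y \<otimes>\<^bsub>grp2 X\<^esub> x"
proof -
  interpret B: group "grp2 X" by (rule crossed_moduleD(2)[OF X])
  have xc: "x \<in> carrier (grp2 X)" and bx: "bd X x = \<one>\<^bsub>grp1 X\<^esub>" using x by (auto simp: carrier_pi2)
  have "y = inv\<^bsub>grp2 X\<^esub> x \<otimes>\<^bsub>grp2 X\<^esub> y \<otimes>\<^bsub>grp2 X\<^esub> x"
    using crossed_moduleD(8)[OF X y xc] crossed_moduleD(5)[OF X y] by (simp add: bx)
  then show ?thesis using xc y by (metis B.inv_solve_left B.m_assoc B.inv_closed B.m_closed)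
qed

text \<open>
  An element \<open>bd X y\<close> acts by conjugation with \<open>y\<close>, hence trivially on the central subgroup
  \<open>\<pi>\<^sub>2\<close>; so the action of a class in \<open>\<pi>\<^sub>1\<close> can be computed on any representative.
\<close>

lemma pi_act_proj1:
  assumes X: "crossed_module X" and x: "x \<in> carrier (pi2 X)" and g: "g \<in> carrier (grp1 X)"
  shows "pi_act X x (proj1 X g) = act X x g"
proof -
  interpret A: group "grp1 X" by (rule crossed_moduleD(1)[OF X])
  interpret B: group "grp2 X" by (rule crossed_moduleD(2)[OF X])
  interpret b: group_hom "grp2 X" "grp1 X" "bd X" by (rule crossed_moduleD(3)[OF X])
  have xc: "x \<in> carrier (grp2 X)" using x by (simp add: carrier_pi2)
  have const: "act X x (bd X y \<otimes>\<^bsub>grp1 X\<^esub> g) = act X x g" if y: "y \<in> carrier (grp2 X)" for y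
  proof -
    have "act X x (bd X y) = inv\<^bsub>grp2 X\<^esub> y \<otimes>\<^bsub>grp2 X\<^esub> (y \<otimes>\<^bsub>grp2 X\<^esub> x)"
      using crossed_moduleD(8)[OF X xc y] pi2_central[OF X x y] xc y by (simp add: B.m_assoc)
    also have "\<dots> = x" using xc y by (simp add: B.m_assoc[symmetric])
    finally show ?thesis using crossed_moduleD(6)[OF X xc _ g] y by simp
  qed
  have "act X x ` proj1 X g = {act X x g}"
  proof
    show "act X x ` proj1 X g \<subseteq> {act X x g}"
      using const by (auto simp: proj1_def r_coset_def)
    have "g = bd X \<one>\<^bsub>grp2 X\<^esub> \<otimes>\<^bsub>grp1 X\<^esub> g" using g by simp
    then show "{act X x g} \<subseteq> act X x ` proj1 X g"
      unfolding proj1_def r_coset_def using B.one_closed by blast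
  qed
  then show ?thesis by (simp add: pi_act_def)
qed

lemma pi_act_closed:
  assumes X: "crossed_module X" and x: "x \<in> carrier (pi2 X)" and C: "C \<in> carrier (pi1 X)"
  shows "pi_act X x C \<in> carrier (pi2 X)"
proof -
  interpret A: group "grp1 X" by (rule crossed_moduleD(1)[OF X])
  obtain g where g: "g \<in> carrier (grp1 X)" "C = proj1 X g" using C by (auto simp: carrier_pi1)
  have "bd X (act X x g) = \<one>\<^bsub>grp1 X\<^esub>"
    using crossed_moduleD(7)[OF X _ g(1)] x g by (simp add: carrier_pi2)
  then show ?thesis
    using act_closed[OF X _ g(1)] x pi_act_proj1[OF X x g(1)] g by (simp add: carrier_pi2)
qed


text \<open>
  When such a surjection has a homomorphic right inverse, composing that inverse with the
  isomorphism from \<open>\<pi>\<^sub>1\<close> gives a section of \<open>proj1\<close>.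
\<close>

lemma split_2group_of_split_epi:
  assumes X: "crossed_module X" and Q: "group Q" and q: "q \<in> hom (grp1 X) Q"
    and ker: "kernel (grp1 X) Q q = bd X ` carrier (grp2 X)"
    and \<sigma>: "\<sigma> \<in> hom Q (grp1 X)" and q\<sigma>: "\<And>z. z \<in> carrier Q \<Longrightarrow> q (\<sigma> z) = z"
  shows "split_2group X" and "pi1 X \<cong> Q"
proof -
  have surj: "q ` carrier (grp1 X) = carrier Q"
    using q \<sigma> q\<sigma> by (force simp: hom_def Pi_iff image_iff)
  obtain h where h: "h \<in> iso (pi1 X) Q" and hq: "\<forall>g\<in>carrier (grp1 X). h (proj1 X g) = q g"
    using pi1_iso_of_epi[OF X Q q surj ker] by (elim bexE)
  show "pi1 X \<cong> Q" using h by (rule is_isoI)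
  have "proj1 X ((\<sigma> \<circ> h) C) = C" if C: "C \<in> carrier (pi1 X)" for C
  proof (rule inj_onD)
    show "inj_on h (carrier (pi1 X))" using h by (simp add: iso_def bij_betw_def)
    have hC: "h C \<in> carrier Q" using h C by (auto simp: iso_def hom_def)
    then have \<sigma>C: "\<sigma> (h C) \<in> carrier (grp1 X)" using \<sigma> by (auto simp: hom_def)
    then show "h (proj1 X ((\<sigma> \<circ> h) C)) = h C" using hq q\<sigma>[OF hC] by simp
    show "proj1 X ((\<sigma> \<circ> h) C) \<in> carrier (pi1 X)" using \<sigma>C by (simp add: carrier_pi1)
  qed (rule C)
  moreover have "\<sigma> \<circ> h \<in> hom (pi1 X) (grp1 X)"
    using h by (intro hom_compose[OF _ \<sigma>]) (simp add: iso_def)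
  ultimately show "split_2group X"
    unfolding split_2group_def by (intro conjI X bexI[of _ "\<sigma> \<circ> h"] ballI)
qed


section \<open>Equivalence of split 2-groups\<close>

lemma same_homotopy_groups_sym:
  assumes X: "crossed_module X" and "same_homotopy_groups X Y"
  shows "same_homotopy_groups Y X"
proof -
  obtain \<alpha> \<beta> where \<alpha>: "\<alpha> \<in> iso (pi1 X) (pi1 Y)" and \<beta>: "\<beta> \<in> iso (pi2 X) (pi2 Y)"
    and comp: "\<And>x C. x \<in> carrier (pi2 X) \<Longrightarrow> C \<in> carrier (pi1 X)
        \<Longrightarrow> \<beta> (pi_act X x C) = pi_act Y (\<beta> x) (\<alpha> C)"
    using assms(2) unfolding same_homotopy_groups_def by blast
  let ?a = "inv_into (carrier (pi1 X)) \<alpha>" and ?b = "inv_into (carrier (pi2 X)) \<beta>"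
  have "?a \<in> iso (pi1 Y) (pi1 X)" "?b \<in> iso (pi2 Y) (pi2 X)"
    using group.iso_set_sym[OF group_pi1[OF X] \<alpha>] group.iso_set_sym[OF group_pi2[OF X] \<beta>] .
  moreover have "?b (pi_act Y y D) = pi_act X (?b y) (?a D)"
    if y: "y \<in> carrier (pi2 Y)" and D: "D \<in> carrier (pi1 Y)" for y D
  proof -
    obtain x C where x: "x \<in> carrier (pi2 X)" "y = \<beta> x" and C: "C \<in> carrier (pi1 X)" "D = \<alpha> C"
      using y D \<alpha> \<beta> unfolding iso_def bij_betw_def by blast
    have inj: "inj_on \<alpha> (carrier (pi1 X))" "inj_on \<beta> (carrier (pi2 X))"
      using \<alpha> \<beta> by (auto simp: iso_def bij_betw_def)
    show ?thesis
      using inj x C pi_act_closed[OF X x(1) C(1)] by (simp add: comp[symmetric])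
  qed
  ultimately show ?thesis unfolding same_homotopy_groups_def by blast
qed

lemma same_homotopy_groups_trans:
  assumes "same_homotopy_groups X Y" "same_homotopy_groups Y Z"
  shows "same_homotopy_groups X Z"
proof -
  obtain \<alpha> \<beta> where 1: "\<alpha> \<in> iso (pi1 X) (pi1 Y)" "\<beta> \<in> iso (pi2 X) (pi2 Y)"
    "\<forall>x\<in>carrier (pi2 X). \<forall>C\<in>carrier (pi1 X). \<beta> (pi_act X x C) = pi_act Y (\<beta> x) (\<alpha> C)"
    using assms(1) unfolding same_homotopy_groups_def by blast
  obtain \<alpha>' \<beta>' where 2: "\<alpha>' \<in> iso (pi1 Y) (pi1 Z)" "\<beta>' \<in> iso (pi2 Y) (pi2 Z)"
    "\<forall>x\<in>carrier (pi2 Y). \<forall>C\<in>carrier (pi1 Y). \<beta>' (pi_act Y x C) = pi_act Z (\<beta>' x) (\<alpha>' C)"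
    using assms(2) unfolding same_homotopy_groups_def by blast
  have "\<alpha> C \<in> carrier (pi1 Y)" if "C \<in> carrier (pi1 X)" for C
    using 1 that by (auto simp: iso_def hom_def)
  moreover have "\<beta> x \<in> carrier (pi2 Y)" if "x \<in> carrier (pi2 X)" for x
    using 1 that by (auto simp: iso_def hom_def)
  ultimately show ?thesis
    unfolding same_homotopy_groups_def
    using 1 2 iso_set_trans[OF 1(1) 2(1)] iso_set_trans[OF 1(2) 2(2)]
    by (intro bexI[of _ "\<alpha>' \<circ> \<alpha>"] bexI[of _ "\<beta>' \<circ> \<beta>"]) simp_all
qed

text \<open>
  The induced isomorphisms respect the actions because \<open>pi_act\<close> can be computed on
  representatives, where the morphism is equivariant.
\<close>

lemma weak_equivalence_same_homotopy_groups:
  assumes K: "crossed_module K" and X: "crossed_module X" and w: "weak_equivalence K X f1 f2"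
  shows "same_homotopy_groups K X"
proof -
  obtain h where h: "h \<in> iso (pi1 K) (pi1 X)"
    and hp: "\<And>g. g \<in> carrier (grp1 K) \<Longrightarrow> h (proj1 K g) = proj1 X (f1 g)"
    and f2: "f2 \<in> iso (pi2 K) (pi2 X)" and m: "xmod_morphism K X f1 f2"
    using w unfolding weak_equivalence_def by blast
  have "f2 (pi_act K x C) = pi_act X (f2 x) (h C)"
    if x: "x \<in> carrier (pi2 K)" and C: "C \<in> carrier (pi1 K)" for x C
  proof -
    obtain g where g: "g \<in> carrier (grp1 K)" "C = proj1 K g" using C by (auto simp: carrier_pi1)
    have "f1 g \<in> carrier (grp1 X)" "f2 x \<in> carrier (pi2 X)"
      using m f2 g x by (auto simp: xmod_morphism_def iso_def hom_def)
    then show ?thesis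
      using g x m pi_act_proj1[OF K x g(1)] pi_act_proj1[OF X]
      by (simp add: hp xmod_morphism_def carrier_pi2)
  qed
  then show ?thesis unfolding same_homotopy_groups_def using h f2 by blast
qed

text \<open>
  Out of a crossed module with trivial boundary, isomorphisms of the homotopy groups can be realised
  by a morphism as soon as the target is split: compose the isomorphism of \<open>\<pi>\<^sub>1\<close> with a section.
\<close>

lemma weak_equivalence_to_split:
  assumes K: "crossed_module K" and triv: "\<forall>x\<in>carrier (grp2 K). bd K x = \<one>\<^bsub>grp1 K\<^esub>"
    and split: "split_2group X" and same: "same_homotopy_groups K X"
  shows "\<exists>f1 f2. weak_equivalence K X f1 f2"
proof -
  obtain s where X: "crossed_module X" and s: "s \<in> hom (pi1 X) (grp1 X)"
    and ps: "\<And>C. C \<in> carrier (pi1 X) \<Longrightarrow> proj1 X (s C) = C"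
    using split unfolding split_2group_def by blast
  obtain \<alpha> \<beta> where \<alpha>: "\<alpha> \<in> iso (pi1 K) (pi1 X)" and \<beta>: "\<beta> \<in> iso (pi2 K) (pi2 X)"
    and comp: "\<And>x C. x \<in> carrier (pi2 K) \<Longrightarrow> C \<in> carrier (pi1 K)
        \<Longrightarrow> \<beta> (pi_act K x C) = pi_act X (\<beta> x) (\<alpha> C)"
    using same unfolding same_homotopy_groups_def by blast
  let ?f = "s \<circ> (\<alpha> \<circ> proj1 K)"
  have carr: "carrier (pi2 K) = carrier (grp2 K)" using triv by (auto simp: carrier_pi2)
  have \<alpha>c: "\<alpha> (proj1 K g) \<in> carrier (pi1 X)" if "g \<in> carrier (grp1 K)" for g
    using \<alpha> that by (auto simp: iso_def hom_def carrier_pi1 Pi_iff)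
  have \<beta>c: "\<beta> x \<in> carrier (pi2 X)" if "x \<in> carrier (grp2 K)" for x
    using \<beta> that by (auto simp: iso_def hom_def carr Pi_iff)
  have f1: "?f \<in> hom (grp1 K) (grp1 X)"
    using \<alpha> by (intro hom_compose[OF _ s] hom_compose[OF proj1_hom[OF K]]) (simp add: iso_def)
  have f2: "\<beta> \<in> hom (grp2 K) (grp2 X)"
    using \<beta> carr by (auto simp: iso_def hom_def pi2_def kernel_def)
  have "?f (bd K x) = bd X (\<beta> x)" if x: "x \<in> carrier (grp2 K)" for x
    using hom_one[OF f1 crossed_moduleD(1)[OF K] crossed_moduleD(1)[OF X]] \<beta>c[OF x] bspec[OF triv x]
    by (simp add: carrier_pi2)
  moreover have "\<beta> (act K x g) = act X (\<beta> x) (?f g)"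
    if x: "x \<in> carrier (grp2 K)" and g: "g \<in> carrier (grp1 K)" for x g
  proof -
    have "s (\<alpha> (proj1 K g)) \<in> carrier (grp1 X)" using s \<alpha>c[OF g] by (auto simp: hom_def)
    then have "act X (\<beta> x) (?f g) = pi_act X (\<beta> x) (\<alpha> (proj1 K g))"
      using pi_act_proj1[OF X \<beta>c[OF x], of "?f g"] ps[OF \<alpha>c[OF g]] by simp
    moreover have "\<beta> (act K x g) = pi_act X (\<beta> x) (\<alpha> (proj1 K g))"
      using comp[of x "proj1 K g"] x g pi_act_proj1[OF K _ g, of x] by (simp add: carr carrier_pi1)
    ultimately show ?thesis by simp
  qed
  ultimately have "xmod_morphism K X ?f \<beta>"
    unfolding xmod_morphism_def using f1 f2 by blast
  moreover have "\<forall>g\<in>carrier (grp1 K). \<alpha> (proj1 K g) = proj1 X (?f g)"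
    using ps \<alpha>c by simp
  ultimately show ?thesis unfolding weak_equivalence_def using \<alpha> \<beta> by blast
qed

text \<open>
  The image of a section is a copy of \<open>\<pi>\<^sub>1\<close> inside \<open>grp1 X\<close>, so a split 2-group has the homotopy
  groups of a crossed module \<open>[\<pi>\<^sub>2 \<rightarrow> \<pi>\<^sub>1]\<close> with trivial boundary made of subgroups of \<open>grp1 X\<close>
  and \<open>grp2 X\<close>.  The factors \<open>singleton_group undefined\<close> only enlarge the types, so that the
  result can serve as the apex of a span in \<open>equivalent_2groups\<close>.
\<close>

lemma split_minimal_model:
  fixes X :: "('a, 'b) xmod"
  assumes split: "split_2group X"
  obtains K :: "('a \<times> 'd, 'b \<times> 'd) xmod" where "crossed_module K"
    "\<forall>x\<in>carrier (grp2 K). bd K x = \<one>\<^bsub>grp1 K\<^esub>" "same_homotopy_groups K X"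
proof -
  obtain s where X: "crossed_module X" and s: "s \<in> hom (pi1 X) (grp1 X)"
    and ps: "\<And>C. C \<in> carrier (pi1 X) \<Longrightarrow> proj1 X (s C) = C"
    using split unfolding split_2group_def by blast
  interpret A: group "grp1 X" by (rule crossed_moduleD(1)[OF X])
  interpret B: group "grp2 X" by (rule crossed_moduleD(2)[OF X])
  interpret P: group "pi1 X" by (rule group_pi1[OF X])
  interpret P2: group "pi2 X" by (rule group_pi2[OF X])
  interpret s: group_hom "pi1 X" "grp1 X" s
    using s by (simp add: group_hom_def group_hom_axioms_def A.is_group P.is_group)
  interpret p: group_hom "grp1 X" "pi1 X" "proj1 X"
    using proj1_hom[OF X] by (simp add: group_hom_def group_hom_axioms_def A.is_group P.is_group)
  define S where "S = (grp1 X)\<lparr>carrier := s ` carrier (pi1 X)\<rparr>"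
  interpret S: group S
    unfolding S_def by (rule subgroup.subgroup_is_group[OF s.img_is_subgroup A.is_group])
  have Sc: "g \<in> carrier S \<Longrightarrow> g \<in> carrier (grp1 X)" for g by (auto simp: S_def)
  define T where "T = singleton_group (undefined :: 'd)"
  have T: "group T" "carrier T = {undefined}" "\<one>\<^bsub>T\<^esub> = undefined" "\<And>a b. a \<otimes>\<^bsub>T\<^esub> b = undefined"
    unfolding T_def by (simp_all, simp_all add: singleton_group_def)
  interpret T: group T by (rule T(1))
  define K :: "('a \<times> 'd, 'b \<times> 'd) xmod" where
    "K = \<lparr>grp1 = S \<times>\<times> T, grp2 = pi2 X \<times>\<times> T, bd = (\<lambda>_. \<one>\<^bsub>S \<times>\<times> T\<^esub>),
          act = (\<lambda>x g. (act X (fst x) (fst g), undefined))\<rparr>"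
  have gK1: "group (grp1 K)" and gK2: "group (grp2 K)"
    by (auto simp: K_def intro!: DirProd_group S.is_group P2.is_group T(1))
  interpret K1: group "grp1 K" by (rule gK1)
  interpret K2: group "grp2 K" by (rule gK2)
  have c1: "g \<in> carrier (grp1 K) \<longleftrightarrow> fst g \<in> carrier S \<and> snd g = undefined" for g
    by (cases g) (auto simp: K_def T DirProd_def)
  have c2: "x \<in> carrier (grp2 K) \<longleftrightarrow> fst x \<in> carrier (pi2 X) \<and> snd x = undefined" for x
    by (cases x) (auto simp: K_def T DirProd_def)
  have m1: "g \<otimes>\<^bsub>grp1 K\<^esub> h = (fst g \<otimes>\<^bsub>grp1 X\<^esub> fst h, undefined)" for g h
    by (cases g; cases h) (simp add: K_def T DirProd_def S_def)
  have m2: "g \<otimes>\<^bsub>grp2 K\<^esub> h = (fst g \<otimes>\<^bsub>grp2 X\<^esub> fst h, undefined)" for g h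
    by (cases g; cases h) (simp add: K_def T DirProd_def pi2_def)
  have o1: "\<one>\<^bsub>grp1 K\<^esub> = (\<one>\<^bsub>grp1 X\<^esub>, undefined)" by (simp add: K_def T DirProd_def S_def)
  have bdK: "bd K x = \<one>\<^bsub>grp1 K\<^esub>" for x by (simp add: K_def)
  have aK: "act K x g = (act X (fst x) (fst g), undefined)" for x g by (simp add: K_def)
  have act2: "act X x g \<in> carrier (pi2 X)" if "x \<in> carrier (pi2 X)" "g \<in> carrier (grp1 X)" for x g
    using pi_act_closed[OF X that(1), of "proj1 X g"] that pi_act_proj1[OF X that]
    by (simp add: carrier_pi1)
  have sub2: "x \<in> carrier (pi2 X) \<Longrightarrow> x \<in> carrier (grp2 X)" for x by (simp add: carrier_pi2)
  have K: "crossed_module K"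
    unfolding crossed_module_def
  proof (intro conjI ballI gK1 gK2)
    show "bd K \<in> hom (grp2 K) (grp1 K)" by (auto simp: hom_def bdK)
    fix g assume g: "g \<in> carrier (grp1 K)"
    have "act X (fst x \<otimes>\<^bsub>grp2 X\<^esub> fst y) (fst g) = act X (fst x) (fst g) \<otimes>\<^bsub>grp2 X\<^esub> act X (fst y) (fst g)"
      if "x \<in> carrier (grp2 K)" "y \<in> carrier (grp2 K)" for x y
      using crossed_moduleD(4)[OF X, of "fst g"] that g Sc sub2 unfolding c1 c2 hom_def by blast
    then show "(\<lambda>x. act K x g) \<in> hom (grp2 K) (grp2 K)"
      using g Sc act2 unfolding hom_def by (auto simp: c1 c2 aK m2)
  next
    fix x assume x: "x \<in> carrier (grp2 K)"
    show "act K x \<one>\<^bsub>grp1 K\<^esub> = x"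
      using x crossed_moduleD(5)[OF X sub2, of "fst x"] by (cases x) (simp add: o1 aK c2)
    fix y assume y: "y \<in> carrier (grp2 K)"
    have "x \<otimes>\<^bsub>grp2 K\<^esub> y = y \<otimes>\<^bsub>grp2 K\<^esub> x"
      using pi2_central[OF X, of "fst x" "fst y"] x y sub2 by (simp add: m2 c2)
    then have "inv\<^bsub>grp2 K\<^esub> y \<otimes>\<^bsub>grp2 K\<^esub> x \<otimes>\<^bsub>grp2 K\<^esub> y = x"
      using x y by (metis K2.inv_closed K2.inv_solve_left K2.m_assoc K2.m_closed)
    then show "act K x (bd K y) = inv\<^bsub>grp2 K\<^esub> y \<otimes>\<^bsub>grp2 K\<^esub> x \<otimes>\<^bsub>grp2 K\<^esub> y"
      using \<open>act K x \<one>\<^bsub>grp1 K\<^esub> = x\<close> by (simp add: bdK)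
  next
    fix x g h assume "x \<in> carrier (grp2 K)" "g \<in> carrier (grp1 K)" "h \<in> carrier (grp1 K)"
    then show "act K x (g \<otimes>\<^bsub>grp1 K\<^esub> h) = act K (act K x g) h"
      using crossed_moduleD(6)[OF X, of "fst x" "fst g" "fst h"] Sc sub2 by (simp add: aK m1 c1 c2)
  next
    fix x g assume "x \<in> carrier (grp2 K)" "g \<in> carrier (grp1 K)"
    then show "bd K (act K x g) = inv\<^bsub>grp1 K\<^esub> g \<otimes>\<^bsub>grp1 K\<^esub> bd K x \<otimes>\<^bsub>grp1 K\<^esub> g"
      by (simp add: bdK)
  qed
  have "proj1 X \<circ> fst \<in> hom (grp1 K) (pi1 X)"
    using Sc by (auto simp: hom_def c1 m1)
  moreover have "(proj1 X \<circ> fst) ` carrier (grp1 K) = carrier (pi1 X)"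
  proof -
    have "C \<in> (proj1 X \<circ> fst) ` carrier (grp1 K)" if "C \<in> carrier (pi1 X)" for C
      using ps[OF that] that by (intro image_eqI[of _ _ "(s C, undefined)"]) (auto simp: c1 S_def)
    then show ?thesis using Sc by (auto simp: c1)
  qed
  moreover have "kernel (grp1 K) (pi1 X) (proj1 X \<circ> fst) = bd K ` carrier (grp2 K)"
  proof -
    have "g = \<one>\<^bsub>grp1 K\<^esub>" if g: "g \<in> carrier (grp1 K)" and pg: "proj1 X (fst g) = \<one>\<^bsub>pi1 X\<^esub>" for g
    proof -
      obtain C where C: "C \<in> carrier (pi1 X)" "fst g = s C" using g by (auto simp: c1 S_def)
      have "C = \<one>\<^bsub>pi1 X\<^esub>" using ps[OF C(1)] pg unfolding C(2) by simp
      then have "fst g = \<one>\<^bsub>grp1 X\<^esub>" using C(2) s.hom_one by simp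
      moreover have "snd g = undefined" using g by (simp add: c1)
      ultimately show ?thesis unfolding o1 by (metis prod.collapse)
    qed
    moreover have "proj1 X (fst \<one>\<^bsub>grp1 K\<^esub>) = \<one>\<^bsub>pi1 X\<^esub>" by (simp add: o1)
    ultimately have "kernel (grp1 K) (pi1 X) (proj1 X \<circ> fst) = {\<one>\<^bsub>grp1 K\<^esub>}"
      unfolding kernel_def using K1.one_closed by (intro equalityI subsetI) simp_all
    also have "\<dots> = bd K ` carrier (grp2 K)"
      unfolding bdK using K2.one_closed by blast
    finally show ?thesis .
  qed
  ultimately obtain \<alpha> where \<alpha>: "\<alpha> \<in> iso (pi1 K) (pi1 X)"
    "\<And>g. g \<in> carrier (grp1 K) \<Longrightarrow> \<alpha> (proj1 K g) = proj1 X (fst g)"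
    using pi1_iso_of_epi[OF K P.is_group, of "proj1 X \<circ> fst"] by auto
  have cK: "carrier (pi2 K) = carrier (grp2 K)" by (auto simp: carrier_pi2 bdK)
  have "bij_betw fst (carrier (pi2 K)) (carrier (pi2 X))"
    by (rule bij_betwI[where g = "\<lambda>x. (x, undefined)"]) (auto simp: cK c2)
  then have "fst \<in> iso (pi2 K) (pi2 X)"
    by (auto simp: iso_def hom_def cK c2) (simp_all add: pi2_def m2)
  moreover have "fst (pi_act K x C) = pi_act X (fst x) (\<alpha> C)"
    if x: "x \<in> carrier (pi2 K)" and C: "C \<in> carrier (pi1 K)" for x C
  proof -
    obtain g where g: "g \<in> carrier (grp1 K)" "C = proj1 K g" using C by (auto simp: carrier_pi1)
    show ?thesis
      using x g pi_act_proj1[OF K x g(1)] pi_act_proj1[OF X, of "fst x" "fst g"] Sc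
      by (simp add: \<alpha>(2) aK cK c1 c2)
  qed
  ultimately have "same_homotopy_groups K X"
    unfolding same_homotopy_groups_def using \<alpha>(1) by (intro bexI[of _ \<alpha>] bexI[of _ fst] ballI)
  then show thesis using that K bdK by blast
qed

text \<open>
  One crossed module with trivial boundary serves as the apex for both legs of the span, because
  each leg only needs its target to be split.
\<close>

lemma split_2groups_equivalent_iff:
  fixes X :: "('a, 'b) xmod" and Y :: "('c, 'd) xmod"
  assumes "split_2group X" "split_2group Y"
  shows "equivalent_2groups X Y \<longleftrightarrow> same_homotopy_groups X Y"
proof
  have X: "crossed_module X" using assms(1) unfolding split_2group_def by (rule conjunct1)
  have Y: "crossed_module Y" using assms(2) unfolding split_2group_def by (rule conjunct1)
  show "same_homotopy_groups X Y" if equiv: "equivalent_2groups X Y"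
  proof -
    obtain K :: "('a \<times> 'd, 'b \<times> 'd) xmod" and f1 f2 g1 g2 where K: "crossed_module K"
      and KX: "weak_equivalence K X f1 f2" and KY: "weak_equivalence K Y g1 g2"
      using equiv unfolding equivalent_2groups_def by (elim exE conjE)
    show ?thesis
      by (rule same_homotopy_groups_trans[OF same_homotopy_groups_sym[OF K]])
        (rule weak_equivalence_same_homotopy_groups[OF K X KX]
          weak_equivalence_same_homotopy_groups[OF K Y KY])+
  qed
  assume same: "same_homotopy_groups X Y"
  obtain K :: "('a \<times> 'd, 'b \<times> 'd) xmod" where K: "crossed_module K"
    and triv: "\<forall>x\<in>carrier (grp2 K). bd K x = \<one>\<^bsub>grp1 K\<^esub>"
    and KX: "same_homotopy_groups K X"
    by (rule split_minimal_model[OF assms(1)]) (rule that)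
  obtain f1 f2 where "weak_equivalence K X f1 f2"
    using weak_equivalence_to_split[OF K triv assms(1) KX] by (elim exE)
  moreover obtain g1 g2 where "weak_equivalence K Y g1 g2"
    using weak_equivalence_to_split[OF K triv assms(2) same_homotopy_groups_trans[OF KX same]] by (elim exE)
  ultimately show "equivalent_2groups X Y"
    unfolding equivalent_2groups_def using K by (intro exI conjI)
qed


section \<open>Regular equivariant functions on the punctured plane\<close>

lemma complex_root_exists:
  fixes z :: complex assumes "0 < k" obtains u where "u ^ k = z"
proof (cases "z = 0")
  case True then show ?thesis using that[of 0] assms by simp
next
  case False
  then have "{u. u ^ k = z} \<noteq> {}"
    using card_nth_roots[OF False assms] assms by (metis card.empty less_irrefl)
  then show ?thesis using that by blast
qed

lemma poly_eqI_off_zeros: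
  fixes A B R :: "complex poly"
  assumes R: "R \<noteq> 0" and eq: "\<And>x. poly R x \<noteq> 0 \<Longrightarrow> poly A x = poly B x"
  shows "A = B"
proof -
  have "poly (R * (A - B)) x = 0" for x using eq[of x] by (cases "poly R x = 0") simp_all
  then have "R * (A - B) = 0" using poly_all_0_iff_0 by blast
  then show ?thesis using R by simp
qed

text \<open>
  Among all pairs \<open>(A, B)\<close> with \<open>g = A / B\<close> almost everywhere take one whose denominator has least
  degree.  If \<open>B\<close> had a root \<open>z\<close>, comparison with a local representation at \<open>z\<close> would show that
  \<open>A\<close> vanishes at \<open>z\<close> too, and \<open>x - z\<close> could be cancelled.
\<close>

lemma locally_rational_imp_polynomial:
  fixes g :: "complex \<Rightarrow> complex"
  assumes local: "\<And>z. \<exists>A B R. poly R z \<noteq> 0 \<and>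
      (\<forall>x. poly R x \<noteq> 0 \<longrightarrow> poly B x \<noteq> 0 \<and> g x = poly A x / poly B x)"
  obtains p where "\<And>x. g x = poly p x"
proof -
  \<comment> \<open>\<open>B\<close> is allowed to be any denominator valid off the zeros of some \<open>R\<close>; this makes all pairs
      comparable, since two nonzero polynomials are both nonzero at some common point.\<close>
  define rep where "rep = (\<lambda>(A, B). B \<noteq> 0 \<and> (\<exists>R. R \<noteq> 0 \<and> (\<forall>x. poly R x \<noteq> 0 \<longrightarrow> g x * poly B x = poly A x)))"
  have cross: "A * B' = A' * B" if "rep (A, B)" "rep (A', B')" for A B A' B'
  proof -
    obtain R R' where R: "R \<noteq> 0" "\<And>x. poly R x \<noteq> 0 \<Longrightarrow> g x * poly B x = poly A x"
      and R': "R' \<noteq> 0" "\<And>x. poly R' x \<noteq> 0 \<Longrightarrow> g x * poly B' x = poly A' x"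
      using \<open>rep (A, B)\<close> \<open>rep (A', B')\<close> unfolding rep_def by auto
    show ?thesis
    proof (rule poly_eqI_off_zeros[of "R * R'"])
      show "R * R' \<noteq> 0" using R(1) R'(1) by simp
      fix x assume "poly (R * R') x \<noteq> 0"
      then have "g x * poly B x = poly A x" "g x * poly B' x = poly A' x" using R(2) R'(2) by auto
      then have "poly A x * poly B' x = poly A' x * poly B x" by (metis mult.assoc mult.commute)
      then show "poly (A * B') x = poly (A' * B) x" by simp
    qed
  qed
  have loc: "\<exists>A B. rep (A, B) \<and> poly B z \<noteq> 0 \<and> g z * poly B z = poly A z" for z
  proof -
    obtain A B R where R: "poly R z \<noteq> 0"
      and "\<forall>x. poly R x \<noteq> 0 \<longrightarrow> poly B x \<noteq> 0 \<and> g x = poly A x / poly B x"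
      using local[of z] by blast
    then have AB: "\<And>x. poly R x \<noteq> 0 \<Longrightarrow> poly B x \<noteq> 0"
      "\<And>x. poly R x \<noteq> 0 \<Longrightarrow> g x * poly B x = poly A x" by auto
    have "R \<noteq> 0" "B \<noteq> 0" using R AB(1)[OF R] by auto
    then have "rep (A, B)" unfolding rep_def using AB(2) by blast
    then show ?thesis using AB(1)[OF R] AB(2)[OF R] by blast
  qed
  obtain A0 B0 where "rep (A0, B0)" using loc by blast
  then obtain A B where AB: "rep (A, B)"
    and least: "\<And>A' B'. rep (A', B') \<Longrightarrow> degree B \<le> degree B'"
    using ex_has_least_nat[of rep "(A0, B0)" "\<lambda>p. degree (snd p)"] by auto
  have B0: "B \<noteq> 0" using AB by (simp add: rep_def)
  have noroot: "poly B z \<noteq> 0" for z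
  proof
    assume Bz: "poly B z = 0"
    obtain A1 B1 where 1: "rep (A1, B1)" "poly B1 z \<noteq> 0" using loc by blast
    have "poly (A * B1) z = poly (A1 * B) z" using cross[OF AB 1(1)] by simp
    then have "poly A z = 0" using Bz 1(2) by simp
    then obtain A' B' where A': "A = [:-z, 1:] * A'" and B': "B = [:-z, 1:] * B'"
      using Bz unfolding poly_eq_0_iff_dvd by (elim dvdE)
    obtain R where R: "R \<noteq> 0" "\<And>x. poly R x \<noteq> 0 \<Longrightarrow> g x * poly B x = poly A x"
      using AB unfolding rep_def by auto
    have "g x * poly B' x = poly A' x" if "poly (R * [:-z, 1:]) x \<noteq> 0" for x
    proof -
      have "x \<noteq> z" "g x * ((x - z) * poly B' x) = (x - z) * poly A' x"
        using that R(2)[of x] by (auto simp: A' B' algebra_simps)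
      then show ?thesis by (simp add: mult.left_commute)
    qed
    moreover have "R * [:-z, 1:] \<noteq> 0" using R(1) by (metis mult_eq_0_iff pCons_eq_0_iff one_neq_zero)
    moreover have "B' \<noteq> 0" using B0 B' by auto
    ultimately have "rep (A', B')" unfolding rep_def by blast
    moreover have "degree B = Suc (degree B')" unfolding B' using \<open>B' \<noteq> 0\<close> by (subst degree_mult_eq) auto
    ultimately show False using least by fastforce
  qed
  then obtain c where c: "B = [:c:]" "c \<noteq> 0"
    using fundamental_theorem_of_algebra_alt[of B] B0 by auto
  have "g x = poly (smult (1 / c) A) x" for x
  proof -
    obtain A1 B1 where 1: "rep (A1, B1)" "poly B1 x \<noteq> 0" "g x * poly B1 x = poly A1 x" using loc by blast
    have "poly (A * B1) x = poly (A1 * B) x" using cross[OF AB 1(1)] by simp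
    then have "poly A x * poly B1 x = g x * poly B1 x * c" using 1(3) c by simp
    then have "poly A x = g x * c" using 1(2) by simp
    then show ?thesis using c(2) by simp
  qed
  then show ?thesis using that by blast
qed

lemma eval2_horizontal: "eval2 P (x, y) = poly (poly P [:y:]) x"
  by (simp add: eval2_def)

lemma eval2_vertical: "eval2 P (x, y) = poly (map_poly (\<lambda>p. poly p x) P) y"
  by (induction P) (simp_all add: eval2_def map_poly_pCons)

text \<open>
  The lines \<open>y = 1\<close> and \<open>x = 1\<close> avoid the origin and together meet every orbit of a weighted
  action with positive weights.  Restriction to them replaces the extension of regular functions
  over the origin by an argument in one variable.
\<close>

lemma regular_function_on_lines:
  assumes h: "regular_function_on punctured_plane h"
  shows "\<exists>p. \<forall>x. h (x, 1) = poly p x" and "\<exists>q. \<forall>y. h (1, y) = poly q y"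
proof -
  have loc: "\<exists>P Q S. eval2 S p \<noteq> 0 \<and>
      (\<forall>q. eval2 S q \<noteq> 0 \<longrightarrow> eval2 Q q \<noteq> 0 \<and> h q = eval2 P q / eval2 Q q)"
    if "p \<in> punctured_plane" for p
  proof -
    obtain U P Q where U: "zariski_open U" "p \<in> U"
      and PQ: "\<forall>q\<in>U. eval2 Q q \<noteq> 0 \<and> h q = eval2 P q / eval2 Q q"
      using h \<open>p \<in> punctured_plane\<close> unfolding regular_function_on_def by blast
    obtain \<S> where \<S>: "U = {p. \<exists>P\<in>\<S>. eval2 P p \<noteq> 0}" using U(1) unfolding zariski_open_def by blast
    then obtain S where "S \<in> \<S>" "eval2 S p \<noteq> 0" using U(2) by blast
    then show ?thesis using PQ unfolding \<S> by blast
  qed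
  have "\<exists>A B R. poly R z \<noteq> 0 \<and> (\<forall>x. poly R x \<noteq> 0 \<longrightarrow> poly B x \<noteq> 0 \<and> h (x, 1) = poly A x / poly B x)" for z
  proof -
    obtain P Q S where S: "eval2 S (z, 1) \<noteq> 0"
      "\<forall>q. eval2 S q \<noteq> 0 \<longrightarrow> eval2 Q q \<noteq> 0 \<and> h q = eval2 P q / eval2 Q q"
      using loc[of "(z, 1)"] by (auto simp: punctured_plane_def)
    show ?thesis
      using S by (intro exI[of _ "poly P [:1:]"] exI[of _ "poly Q [:1:]"] exI[of _ "poly S [:1:]"])
        (auto simp: eval2_horizontal)
  qed
  from locally_rational_imp_polynomial[OF this] show "\<exists>p. \<forall>x. h (x, 1) = poly p x" by metis
  have "\<exists>A B R. poly R z \<noteq> 0 \<and> (\<forall>x. poly R x \<noteq> 0 \<longrightarrow> poly B x \<noteq> 0 \<and> h (1, x) = poly A x / poly B x)" for z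
  proof -
    obtain P Q S where S: "eval2 S (1, z) \<noteq> 0"
      "\<forall>q. eval2 S q \<noteq> 0 \<longrightarrow> eval2 Q q \<noteq> 0 \<and> h q = eval2 P q / eval2 Q q"
      using loc[of "(1, z)"] by (auto simp: punctured_plane_def)
    show ?thesis
      using S by (intro exI[of _ "map_poly (\<lambda>p. poly p 1) P"] exI[of _ "map_poly (\<lambda>p. poly p 1) Q"]
          exI[of _ "map_poly (\<lambda>p. poly p 1) S"]) (auto simp: eval2_vertical)
  qed
  from locally_rational_imp_polynomial[OF this] show "\<exists>q. \<forall>y. h (1, y) = poly q y" by metis
qed

text \<open>
  Compare degrees after multiplication by the power of \<open>u\<close> that clears the denominators of
  \<open>p (1 / u^m)\<close>.
\<close>

lemma weighted_degree_le:
  fixes p q :: "complex poly"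
  assumes "\<And>u. u \<noteq> 0 \<Longrightarrow> poly q (u ^ n) = u ^ w * poly p (inverse (u ^ m))"
  shows "n * degree q \<le> w"
proof (cases "q = 0")
  case False
  let ?D = "m * degree p"
  have eq: "monom 1 ?D * (q \<circ>\<^sub>p monom 1 n) = monom 1 w * (reflect_poly p \<circ>\<^sub>p monom 1 m)"
  proof (rule poly_eqI_off_zeros[of "[:0, 1:]"])
    fix u :: complex assume "poly [:0, 1:] u \<noteq> 0"
    then have u: "u \<noteq> 0" by simp
    then have "poly (reflect_poly p) (u ^ m) = u ^ ?D * poly p (inverse (u ^ m))"
      by (simp add: poly_reflect_poly_nz power_mult)
    then show "poly (monom 1 ?D * (q \<circ>\<^sub>p monom 1 n)) u = poly (monom 1 w * (reflect_poly p \<circ>\<^sub>p monom 1 m)) u"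
      using assms[OF u] by (simp add: poly_pcompose poly_monom)
  qed simp
  have "degree (q \<circ>\<^sub>p monom 1 n) = degree q * n"
    by (simp add: degree_pcompose degree_monom_eq)
  show ?thesis
  proof (cases "q \<circ>\<^sub>p monom 1 n = 0")
    case True
    then have "degree q * n = 0" using \<open>degree (q \<circ>\<^sub>p monom 1 n) = degree q * n\<close> by simp
    then show ?thesis by auto
  next
    case False
    then have "degree (monom 1 ?D * (q \<circ>\<^sub>p monom 1 n)) = ?D + degree q * n"
      by (simp add: degree_mult_eq degree_pcompose degree_monom_eq)
    moreover have "degree (monom 1 w * (reflect_poly p \<circ>\<^sub>p monom 1 m)) \<le> w + degree (reflect_poly p) * m"
      by (rule order_trans[OF degree_mult_le]) (simp add: degree_pcompose degree_monom_eq)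
    moreover have "degree (reflect_poly p) * m \<le> ?D"
      using degree_reflect_poly_le[of p] by (simp add: mult.commute)
    ultimately have "?D + degree q * n \<le> w + ?D" using arg_cong[OF eq, of degree] by linarith
    then show ?thesis by (simp add: mult.commute)
  qed
qed simp

definition semi_invariant :: "nat \<Rightarrow> nat \<Rightarrow> nat \<Rightarrow> (complex \<times> complex \<Rightarrow> complex) \<Rightarrow> bool" where
  "semi_invariant m n w h \<longleftrightarrow>
     (\<forall>t p. t \<noteq> 0 \<longrightarrow> p \<in> punctured_plane \<longrightarrow> h (weighted_action m n t p) = t ^ w * h p)"

text \<open>
  If \<open>m\<close> and \<open>n\<close> are positive, these formulas recover a semi-invariant function from its values
  on the two lines.  The two restrictions determine each other, since \<open>(1, u^n)\<close> and \<open>(1 / u^m, 1)\<close> lie on the same orbit.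
\<close>

lemma semi_invariant_restrictions:
  assumes h: "semi_invariant m n w h" and p: "\<And>x. h (x, 1) = poly p x" and q: "\<And>y. h (1, y) = poly q y"
  shows "u \<noteq> 0 \<Longrightarrow> h (x, u ^ n) = u ^ w * poly p (x / u ^ m)"
    and "u \<noteq> 0 \<Longrightarrow> poly q (u ^ n) = u ^ w * poly p (inverse (u ^ m))"
    and "u \<noteq> 0 \<Longrightarrow> h (u ^ m, 0) = u ^ w * poly q 0"
    and "u \<noteq> 0 \<Longrightarrow> poly p (u ^ m) = u ^ w * poly q (inverse (u ^ n))"
proof -
  assume u: "u \<noteq> 0"
  have h': "h (t ^ m * x, t ^ n * y) = t ^ w * h (x, y)" if "t \<noteq> 0" "(x, y) \<noteq> (0, 0)" for t x y
    using h that unfolding semi_invariant_def weighted_action_def punctured_plane_def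
    by (metis DiffI UNIV_I fst_conv singletonD snd_conv)
  show *: "h (x, u ^ n) = u ^ w * poly p (x / u ^ m)" for x
    using h'[OF u, of "x / u ^ m" 1] u by (simp add: p)
  show "poly q (u ^ n) = u ^ w * poly p (inverse (u ^ m))"
    using *[of 1] by (simp add: q inverse_eq_divide)
  show "h (u ^ m, 0) = u ^ w * poly q 0"
    using h'[OF u, of 1 0] by (simp add: q)
  show "poly p (u ^ m) = u ^ w * poly q (inverse (u ^ n))"
    using h'[OF u, of 1 "inverse (u ^ n)"] u by (simp add: q p)
qed

lemma degree_le_1_poly: "degree p \<le> 1 \<Longrightarrow> p = [:coeff p 0, coeff p 1:]"
  by (rule poly_eqI) (auto simp: coeff_pCons coeff_eq_0 split: nat.split)

text \<open>
  Weight \<open>m\<close>: the restriction to \<open>x = 1\<close> has degree at most \<open>m / n < 1\<close>, so it is constant, and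
  the restriction to \<open>y = 1\<close> is linear.
\<close>

lemma semi_invariant_first:
  assumes mn: "0 < m" "m < n" and h: "regular_function_on punctured_plane h" "semi_invariant m n m h"
  obtains a where "\<And>x y. (x, y) \<noteq> (0, 0) \<Longrightarrow> h (x, y) = a * x"
proof -
  obtain p q where p: "\<And>x. h (x, 1) = poly p x" and q: "\<And>y. h (1, y) = poly q y"
    using regular_function_on_lines[OF h(1)] by blast
  note r = semi_invariant_restrictions[OF h(2) p q]
  have "n * degree q \<le> m" by (rule weighted_degree_le) (rule r(2))
  then have "degree q = 0" using mn by (cases "degree q") auto
  then obtain a where a: "q = [:a:]" by (rule degree_eq_zeroE)
  have pv: "poly p v = a * v" if "v \<noteq> 0" for v
  proof -
    obtain u where u: "u ^ m = v" using complex_root_exists[OF mn(1)] .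
    then have "u \<noteq> 0" using \<open>v \<noteq> 0\<close> mn(1) by auto
    from r(4)[OF this] show ?thesis by (simp add: u a mult.commute)
  qed
  have "p = [:0, a:]"
    by (rule poly_eqI_off_zeros[of "[:0, 1:]"]) (auto simp: pv mult.commute)
  then have pv': "poly p v = a * v" for v by simp
  have "h (x, y) = a * x" if xy: "(x, y) \<noteq> (0, 0)" for x y
  proof (cases "y = 0")
    case True
    obtain u where u: "u ^ m = x" using complex_root_exists[OF mn(1)] .
    then have "u \<noteq> 0" using xy True mn(1) by auto
    from r(3)[OF this] show ?thesis by (simp add: u True a mult.commute)
  next
    case False
    have "0 < n" using mn by simp
    then obtain u where u: "u ^ n = y" by (rule complex_root_exists)
    then have "u \<noteq> 0" using False \<open>0 < n\<close> by auto
    from r(1)[OF this, of x] show ?thesis using \<open>u \<noteq> 0\<close> by (simp add: u pv')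
  qed
  then show thesis by (rule that)
qed

text \<open>
  Weight \<open>n\<close>: the restriction to \<open>x = 1\<close> is some \<open>c + b y\<close>, which makes the restriction \<open>p\<close> to
  \<open>y = 1\<close> satisfy \<open>p (u^m) = b + c u^n\<close>.  So \<open>c u^n\<close> is a function of \<open>u^m\<close>, which leaves
  \<open>c = 0\<close> unless \<open>m\<close> divides \<open>n\<close>.
\<close>

lemma semi_invariant_second:
  assumes mn: "0 < m" "m < n" and h: "regular_function_on punctured_plane h" "semi_invariant m n n h"
  obtains b c where "c = 0 \<or> m dvd n"
    "\<And>x y. (x, y) \<noteq> (0, 0) \<Longrightarrow> h (x, y) = b * y + c * x ^ (n div m)"
proof -
  have n: "0 < n" using mn by simp
  obtain p q where p: "\<And>x. h (x, 1) = poly p x" and q: "\<And>y. h (1, y) = poly q y"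
    using regular_function_on_lines[OF h(1)] by blast
  note r = semi_invariant_restrictions[OF h(2) p q]
  have "n * degree q \<le> n" by (rule weighted_degree_le) (rule r(2))
  then have "degree q \<le> 1" using n by simp
  then obtain b c where bc: "q = [:c, b:]" using degree_le_1_poly by blast
  have pu: "poly p (u ^ m) = b + c * u ^ n" if "u \<noteq> 0" for u
    using r(4)[OF that] that by (simp add: bc distrib_left)
  have dvd: "c = 0 \<or> m dvd n"
  proof (cases "c = 0")
    case False
    have "p \<circ>\<^sub>p monom 1 m = [:b:] + monom c n"
      by (rule poly_eqI_off_zeros[of "[:0, 1:]"]) (auto simp: poly_pcompose poly_monom pu)
    moreover have "degree ([:b:] + monom c n) = n"
      using False n by (subst degree_add_eq_right) (auto simp: degree_monom_eq)
    ultimately have "degree p * m = n"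
      by (metis degree_pcompose degree_monom_eq one_neq_zero)
    then show ?thesis by auto
  qed simp
  have power: "c * u ^ n = c * (u ^ m) ^ (n div m)" for u
    using dvd by (auto simp flip: power_mult)
  have k: "0 < n div m" using mn by (simp add: div_greater_zero_iff)
  have pv: "poly p v = b + c * v ^ (n div m)" if "v \<noteq> 0" for v
  proof -
    obtain u where u: "u ^ m = v" using complex_root_exists[OF mn(1)] .
    then have "u \<noteq> 0" using \<open>v \<noteq> 0\<close> mn(1) by auto
    from pu[OF this] show ?thesis by (simp add: power u)
  qed
  have "p = [:b:] + monom c (n div m)"
    by (rule poly_eqI_off_zeros[of "[:0, 1:]"]) (auto simp: pv poly_monom)
  then have pv': "poly p v = b + c * v ^ (n div m)" for v by (simp add: poly_monom)
  have "h (x, y) = b * y + c * x ^ (n div m)" if xy: "(x, y) \<noteq> (0, 0)" for x y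
  proof (cases "y = 0")
    case True
    obtain u where u: "u ^ m = x" using complex_root_exists[OF mn(1)] .
    then have "u \<noteq> 0" using xy True mn(1) by auto
    from r(3)[OF this] show ?thesis using power[of u] by (simp add: u True bc mult.commute)
  next
    case False
    obtain u where u: "u ^ n = y" using complex_root_exists[OF n] .
    then have u0: "u \<noteq> 0" using False n by auto
    have "h (x, y) = u ^ n * (b + c * (x / u ^ m) ^ (n div m))"
      using r(1)[OF u0, of x] by (simp add: u pv')
    also have "\<dots> = b * y + x ^ (n div m) * (c * u ^ n / (u ^ m) ^ (n div m))"
      by (simp add: u power_divide algebra_simps)
    also have "c * u ^ n / (u ^ m) ^ (n div m) = c"
      using power[of u] u0 by (simp add: power_eq_0_iff nonzero_divide_eq_eq)
    finally show ?thesis by (simp add: mult.commute)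
  qed
  then show thesis by (rule that[OF dvd])
qed


section \<open>The group of equivariant automorphisms\<close>

text \<open>
  These maps are restricted to the punctured plane because elements of \<open>BijGroup\<close> are extensional.
\<close>

definition triangular_map ::
  "nat \<Rightarrow> complex \<Rightarrow> complex \<Rightarrow> complex \<Rightarrow> complex \<times> complex \<Rightarrow> complex \<times> complex" where
  "triangular_map k a b c = (\<lambda>p\<in>punctured_plane. (a * fst p, b * snd p + c * fst p ^ k))"

lemma triangular_map_apply:
  "(x, y) \<noteq> (0, 0) \<Longrightarrow> triangular_map k a b c (x, y) = (a * x, b * y + c * x ^ k)"
  by (auto simp: triangular_map_def punctured_plane_def)

lemma triangular_map_closed:
  assumes "0 < k" "a \<noteq> 0" "b \<noteq> 0" "p \<in> punctured_plane"
  shows "triangular_map k a b c p \<in> punctured_plane"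
  using assms by (cases p) (auto simp: triangular_map_def punctured_plane_def zero_power)

lemma triangular_map_one: "triangular_map k 1 1 0 = (\<lambda>p\<in>punctured_plane. p)"
  by (auto simp: triangular_map_def)

lemma compose_triangular_map:
  assumes "0 < k" "a \<noteq> 0" "b \<noteq> 0"
  shows "compose punctured_plane (triangular_map k a' b' c') (triangular_map k a b c)
    = triangular_map k (a' * a) (b' * b) (b' * c + c' * a ^ k)"
proof
  fix p :: "complex \<times> complex"
  show "compose punctured_plane (triangular_map k a' b' c') (triangular_map k a b c) p
    = triangular_map k (a' * a) (b' * b) (b' * c + c' * a ^ k) p"
  proof (cases "p \<in> punctured_plane")
    case True
    then have "triangular_map k a b c p \<in> punctured_plane" using assms by (intro triangular_map_closed)
    with True show ?thesis
      by (simp add: compose_def triangular_map_def power_mult_distrib algebra_simps)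
  qed (simp add: compose_def triangular_map_def)
qed

lemma triangular_map_coordinates:
  assumes "0 < k"
  shows "triangular_map k a b c (1, 0) = (a, c)" "triangular_map k a b c (0, 1) = (0, b)"
  using assms by (simp_all add: triangular_map_apply)

lemma triangular_map_eq_iff:
  assumes "0 < k"
  shows "triangular_map k a b c = triangular_map k a' b' c' \<longleftrightarrow> a = a' \<and> b = b' \<and> c = c'"
  using triangular_map_coordinates[OF assms] by (metis prod.inject)

lemma triangular_map_inverse:
  assumes "0 < k" "a \<noteq> 0" "b \<noteq> 0"
  shows "triangular_map k a b c \<in> Bij punctured_plane"
    and "p \<in> punctured_plane \<Longrightarrow> inv_into punctured_plane (triangular_map k a b c) p
      = triangular_map k (1 / a) (1 / b) (- c / (b * a ^ k)) p"
proof -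
  let ?f = "triangular_map k a b c" and ?g = "triangular_map k (1 / a) (1 / b) (- c / (b * a ^ k))"
  have closed: "p \<in> punctured_plane \<Longrightarrow> ?f p \<in> punctured_plane"
    "p \<in> punctured_plane \<Longrightarrow> ?g p \<in> punctured_plane" for p
    using assms by (auto intro!: triangular_map_closed)
  have "compose punctured_plane ?g ?f = (\<lambda>p\<in>punctured_plane. p)"
    "compose punctured_plane ?f ?g = (\<lambda>p\<in>punctured_plane. p)"
    using assms by (simp_all add: compose_triangular_map triangular_map_one[symmetric, of k]
        triangular_map_eq_iff power_divide)
  then have inv: "p \<in> punctured_plane \<Longrightarrow> ?g (?f p) = p" "p \<in> punctured_plane \<Longrightarrow> ?f (?g p) = p" for p
    by (metis compose_eq restrict_apply')+
  have bij: "bij_betw ?f punctured_plane punctured_plane"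
    using closed inv by (intro bij_betwI[where g = ?g]) auto
  then show "?f \<in> Bij punctured_plane"
    by (auto simp: Bij_def triangular_map_def)
  show "inv_into punctured_plane ?f p = ?g p" if "p \<in> punctured_plane"
    using inv_into_f_eq[OF bij_betw_imp_inj_on[OF bij] closed(2)[OF that] inv(2)[OF that]] .
qed

lemma zariski_open_punctured_plane: "zariski_open punctured_plane"
  unfolding zariski_open_def
  by (intro exI[of _ "{[:[:0, 1:]:], [:0, 1:]}"]) (auto simp: eval2_def punctured_plane_def)

lemma polynomial_regular_function:
  assumes "\<And>p. p \<in> punctured_plane \<Longrightarrow> h p = eval2 P p"
  shows "regular_function_on punctured_plane h"
  unfolding regular_function_on_def
proof
  fix p assume p: "p \<in> punctured_plane"
  have "\<forall>q\<in>punctured_plane. eval2 1 q \<noteq> 0 \<and> h q = eval2 P q / eval2 1 q"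
    using assms by (simp add: eval2_def)
  then show "\<exists>U P Q. zariski_open U \<and> p \<in> U \<and> U \<subseteq> punctured_plane \<and>
      (\<forall>q\<in>U. eval2 Q q \<noteq> 0 \<and> h q = eval2 P q / eval2 Q q)"
    using zariski_open_punctured_plane p by (intro exI[of _ punctured_plane] exI[of _ P] exI[of _ 1]) simp
qed

lemma triangular_map_regular:
  assumes "0 < k" "a \<noteq> 0" "b \<noteq> 0"
    and f: "\<And>p. p \<in> punctured_plane \<Longrightarrow> f p = triangular_map k a b c p"
  shows "regular_self_map punctured_plane f"
  unfolding regular_self_map_def
proof (intro conjI)
  show "f \<in> punctured_plane \<rightarrow> punctured_plane"
    using f triangular_map_closed[OF assms(1-3)] by simp
  show "regular_function_on punctured_plane (\<lambda>p. fst (f p))"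
    by (rule polynomial_regular_function[of _ "[:[:0, a:]:]"])
      (simp add: f triangular_map_def eval2_def)
  show "regular_function_on punctured_plane (\<lambda>p. snd (f p))"
    by (rule polynomial_regular_function[of _ "[:monom c k, [:b:]:]"])
      (simp add: f triangular_map_def eval2_def poly_monom)
qed

lemma triangular_map_equivariant:
  assumes "c = 0 \<or> n = m * k" "t \<noteq> 0" "p \<in> punctured_plane"
  shows "triangular_map k a b c (weighted_action m n t p) = weighted_action m n t (triangular_map k a b c p)"
proof -
  have "weighted_action m n t p \<in> punctured_plane"
    using assms by (cases p) (auto simp: weighted_action_def punctured_plane_def)
  moreover have "c = 0 \<or> (t ^ m) ^ k = t ^ n"
    using assms(1) by (auto simp: power_mult)
  ultimately show ?thesis
    using assms(3) by (auto simp: triangular_map_def weighted_action_def power_mult_distrib algebra_simps)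
qed

text \<open>
  The two components of an equivariant automorphism are semi-invariant regular functions of weights
  \<open>m\<close> and \<open>n\<close>.  Of the maps with such components, those with \<open>a = 0\<close> miss \<open>(1, 0)\<close> and those
  with \<open>b = 0\<close> send \<open>(0, 1)\<close> to the origin.
\<close>

lemma equivariant_automorphisms_eq:
  assumes mn: "0 < m" "m < n"
  shows "equivariant_automorphisms m n
    = {triangular_map (n div m) a b c | a b c. a \<noteq> 0 \<and> b \<noteq> 0 \<and> (c = 0 \<or> m dvd n)}"
proof (intro equalityI subsetI)
  fix f assume "f \<in> equivariant_automorphisms m n"
  then have bij: "f \<in> Bij punctured_plane" and reg: "regular_self_map punctured_plane f"
    and equi: "\<And>t p. t \<noteq> 0 \<Longrightarrow> p \<in> punctured_plane \<Longrightarrow> f (weighted_action m n t p) = weighted_action m n t (f p)"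
    by (auto simp: equivariant_automorphisms_def Cstar_def)
  obtain a where a: "\<And>x y. (x, y) \<noteq> (0, 0) \<Longrightarrow> fst (f (x, y)) = a * x"
  proof (rule semi_invariant_first[OF mn])
    show "regular_function_on punctured_plane (\<lambda>p. fst (f p))"
      using reg by (simp add: regular_self_map_def)
    show "semi_invariant m n m (\<lambda>p. fst (f p))"
      by (simp add: semi_invariant_def equi) (simp add: weighted_action_def)
  qed (rule that)
  obtain b c where dvd: "c = 0 \<or> m dvd n"
    and bc: "\<And>x y. (x, y) \<noteq> (0, 0) \<Longrightarrow> snd (f (x, y)) = b * y + c * x ^ (n div m)"
  proof (rule semi_invariant_second[OF mn])
    show "regular_function_on punctured_plane (\<lambda>p. snd (f p))"
      using reg by (simp add: regular_self_map_def)
    show "semi_invariant m n n (\<lambda>p. snd (f p))"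
      by (simp add: semi_invariant_def equi) (simp add: weighted_action_def)
  qed (rule that)
  have k: "0 < n div m" using mn by (simp add: div_greater_zero_iff)
  have f: "f = triangular_map (n div m) a b c"
  proof
    fix p show "f p = triangular_map (n div m) a b c p"
    proof (cases "p \<in> punctured_plane")
      case True
      obtain x y where p: "p = (x, y)" by (cases p)
      then have "(x, y) \<noteq> (0, 0)" using True by (auto simp: punctured_plane_def)
      from a[OF this] bc[OF this] triangular_map_apply[OF this] show ?thesis
        by (simp only: p prod_eq_iff fst_conv snd_conv)
    next
      case False
      then show ?thesis
        using extensional_arb[OF Bij_imp_extensional[OF bij]] by (simp add: triangular_map_def)
    qed
  qed
  have onto: "f ` punctured_plane = punctured_plane" using bij by (simp add: Bij_def bij_betw_def)
  have "(1, 0) \<in> f ` punctured_plane" unfolding onto by (simp add: punctured_plane_def)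
  then have "a \<noteq> 0" unfolding f by (auto simp: triangular_map_def)
  moreover have "f (0, 1) \<in> punctured_plane" using Bij_imp_funcset[OF bij] by (auto simp: punctured_plane_def)
  then have "b \<noteq> 0" unfolding f triangular_map_coordinates[OF k] by (simp add: punctured_plane_def)
  ultimately show "f \<in> {triangular_map (n div m) a b c | a b c. a \<noteq> 0 \<and> b \<noteq> 0 \<and> (c = 0 \<or> m dvd n)}"
    using f dvd by blast
next
  fix f assume "f \<in> {triangular_map (n div m) a b c | a b c. a \<noteq> 0 \<and> b \<noteq> 0 \<and> (c = 0 \<or> m dvd n)}"
  then obtain a b c where f: "f = triangular_map (n div m) a b c"
    and abc: "a \<noteq> 0" "b \<noteq> 0" "c = 0 \<or> m dvd n" by blast
  have k: "0 < n div m" using mn by (simp add: div_greater_zero_iff)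
  show "f \<in> equivariant_automorphisms m n"
    unfolding equivariant_automorphisms_def
  proof (intro CollectI conjI ballI)
    show "f \<in> Bij punctured_plane" unfolding f by (rule triangular_map_inverse(1)[OF k abc(1,2)])
    show "regular_self_map punctured_plane f"
      by (rule triangular_map_regular[OF k abc(1,2)]) (simp add: f)
    show "regular_self_map punctured_plane (inv_into punctured_plane f)"
      unfolding f using abc
      by (intro triangular_map_regular[OF k _ _ triangular_map_inverse(2)[OF k abc(1,2)]]) simp_all
    fix t p assume "t \<in> carrier Cstar" "p \<in> punctured_plane"
    then show "f (weighted_action m n t p) = weighted_action m n t (f p)"
      unfolding f using abc(3) by (intro triangular_map_equivariant) (auto simp: Cstar_def)
  qed
qed

lemma carrier_G_group: "carrier (G_group m n) = equivariant_automorphisms m n"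
  by (simp add: G_group_def)

lemma one_G_group: "\<one>\<^bsub>G_group m n\<^esub> = triangular_map k 1 1 0"
  by (simp add: G_group_def BijGroup_def triangular_map_one)

lemma mult_G_group:
  assumes "0 < k" "a \<noteq> 0" "b \<noteq> 0" "a' \<noteq> 0" "b' \<noteq> 0"
  shows "triangular_map k a' b' c' \<otimes>\<^bsub>G_group m n\<^esub> triangular_map k a b c
    = triangular_map k (a' * a) (b' * b) (b' * c + c' * a ^ k)"
  using assms by (simp add: G_group_def BijGroup_def triangular_map_inverse(1) compose_triangular_map)

lemma group_G_group:
  assumes mn: "0 < m" "m < n"
  shows "group (G_group m n)"
proof -
  let ?k = "n div m"
  have k: "0 < ?k" using mn by (simp add: div_greater_zero_iff)
  note carr = carrier_G_group equivariant_automorphisms_eq[OF mn]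
  show ?thesis
  proof (rule groupI)
    fix f g assume "f \<in> carrier (G_group m n)" "g \<in> carrier (G_group m n)"
    then obtain a b c a' b' c' where *: "f = triangular_map ?k a b c" "a \<noteq> 0" "b \<noteq> 0" "c = 0 \<or> m dvd n"
      "g = triangular_map ?k a' b' c'" "a' \<noteq> 0" "b' \<noteq> 0" "c' = 0 \<or> m dvd n"
      unfolding carr by blast
    have "f \<otimes>\<^bsub>G_group m n\<^esub> g = triangular_map ?k (a * a') (b * b') (b * c' + c * a' ^ ?k)"
      using * k by (simp add: mult_G_group)
    moreover have "a * a' \<noteq> 0" "b * b' \<noteq> 0" "b * c' + c * a' ^ ?k = 0 \<or> m dvd n" using * by auto
    ultimately show "f \<otimes>\<^bsub>G_group m n\<^esub> g \<in> carrier (G_group m n)"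
      unfolding carr by blast
    fix h assume "h \<in> carrier (G_group m n)"
    then obtain a'' b'' c'' where **: "h = triangular_map ?k a'' b'' c''" "a'' \<noteq> 0" "b'' \<noteq> 0"
      unfolding carr by blast
    show "f \<otimes>\<^bsub>G_group m n\<^esub> g \<otimes>\<^bsub>G_group m n\<^esub> h = f \<otimes>\<^bsub>G_group m n\<^esub> (g \<otimes>\<^bsub>G_group m n\<^esub> h)"
      using * ** k by (simp add: mult_G_group triangular_map_eq_iff power_mult_distrib algebra_simps)
  next
    show "\<one>\<^bsub>G_group m n\<^esub> \<in> carrier (G_group m n)"
      unfolding carr one_G_group[of m n ?k] by force
  next
    fix f assume "f \<in> carrier (G_group m n)"
    then obtain a b c where *: "f = triangular_map ?k a b c" "a \<noteq> 0" "b \<noteq> 0" "c = 0 \<or> m dvd n"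
      unfolding carr by blast
    show "\<one>\<^bsub>G_group m n\<^esub> \<otimes>\<^bsub>G_group m n\<^esub> f = f"
      using * k by (simp add: one_G_group[of m n ?k] mult_G_group)
    let ?g = "triangular_map ?k (1 / a) (1 / b) (- c / (b * a ^ ?k))"
    have "?g \<otimes>\<^bsub>G_group m n\<^esub> f = \<one>\<^bsub>G_group m n\<^esub>"
      using * k by (simp add: one_G_group[of m n ?k] mult_G_group triangular_map_eq_iff)
    moreover have "?g \<in> carrier (G_group m n)"
    proof -
      have "1 / a \<noteq> 0" "1 / b \<noteq> 0" "- c / (b * a ^ ?k) = 0 \<or> m dvd n" using * by auto
      then show ?thesis unfolding carr by blast
    qed
    ultimately show "\<exists>g\<in>carrier (G_group m n). g \<otimes>\<^bsub>G_group m n\<^esub> f = \<one>\<^bsub>G_group m n\<^esub>" by blast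
  qed
qed

lemma group_Cstar: "group Cstar"
proof (rule groupI)
  fix z assume z: "z \<in> carrier Cstar"
  then have "1 / z \<in> carrier Cstar" "1 / z \<otimes>\<^bsub>Cstar\<^esub> z = \<one>\<^bsub>Cstar\<^esub>" by (auto simp: Cstar_def)
  then show "\<exists>y\<in>carrier Cstar. y \<otimes>\<^bsub>Cstar\<^esub> z = \<one>\<^bsub>Cstar\<^esub>" by blast
qed (auto simp: Cstar_def)


section \<open>PGL(m,n) and its homotopy groups\<close>

lemma group_semidirect_Cstar_Cplus: "group (semidirect Cstar Cplus (*))"
proof (rule groupI)
  fix p assume p: "p \<in> carrier (semidirect Cstar Cplus (*))"
  obtain a z where az: "p = (a, z)" by (cases p)
  have "(1 / a, - z / a) \<in> carrier (semidirect Cstar Cplus (*))"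
    "(1 / a, - z / a) \<otimes>\<^bsub>semidirect Cstar Cplus (*)\<^esub> p = \<one>\<^bsub>semidirect Cstar Cplus (*)\<^esub>"
    using p by (auto simp: az semidirect_def Cstar_def Cplus_def)
  then show "\<exists>q\<in>carrier (semidirect Cstar Cplus (*)).
      q \<otimes>\<^bsub>semidirect Cstar Cplus (*)\<^esub> p = \<one>\<^bsub>semidirect Cstar Cplus (*)\<^esub>" by blast
qed (auto simp: semidirect_def Cstar_def Cplus_def algebra_simps)

lemma PGL_simps:
  "grp1 (PGL m n) = G_group m n" "grp2 (PGL m n) = Cstar" "act (PGL m n) t g = t"
  "bd (PGL m n) t = triangular_map k (t ^ m) (t ^ n) 0"
  by (auto simp: PGL_def triangular_map_def weighted_action_def)

lemma crossed_module_PGL: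
  assumes mn: "0 < m" "m < n"
  shows "crossed_module (PGL m n)"
proof -
  let ?G = "G_group m n" and ?k = "n div m"
  have k: "0 < ?k" using mn by (simp add: div_greater_zero_iff)
  note carr = carrier_G_group equivariant_automorphisms_eq[OF mn]
  note simps = PGL_simps(1-3) PGL_simps(4)[of _ _ _ ?k]
  interpret G: group ?G by (rule group_G_group[OF mn])
  interpret C: group Cstar by (rule group_Cstar)
  have t0: "t \<noteq> 0" if "t \<in> carrier Cstar" for t using that by (simp add: Cstar_def)
  have bd: "triangular_map ?k (t ^ m) (t ^ n) 0 \<in> carrier ?G" if "t \<in> carrier Cstar" for t
  proof -
    have "t ^ m \<noteq> 0" "t ^ n \<noteq> 0" using t0[OF that] by auto
    then show ?thesis unfolding carr by blast
  qed
  \<comment> \<open>The action on \<open>Cstar\<close> is trivial, so the boundary has to be central; this is equivariance.\<close>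
  have "triangular_map ?k (t ^ m) (t ^ n) 0 = inv\<^bsub>?G\<^esub> g \<otimes>\<^bsub>?G\<^esub> triangular_map ?k (t ^ m) (t ^ n) 0 \<otimes>\<^bsub>?G\<^esub> g"
    if t: "t \<in> carrier Cstar" and g: "g \<in> carrier ?G" for t g
  proof -
    obtain a b c where abc: "g = triangular_map ?k a b c" "a \<noteq> 0" "b \<noteq> 0" "c = 0 \<or> m dvd n"
      using g unfolding carr by blast
    have "c * (t ^ m) ^ ?k = t ^ n * c"
      using abc(4) by (auto simp flip: power_mult)
    then have "triangular_map ?k (t ^ m) (t ^ n) 0 \<otimes>\<^bsub>?G\<^esub> g = g \<otimes>\<^bsub>?G\<^esub> triangular_map ?k (t ^ m) (t ^ n) 0"
      using abc k t0[OF t] by (auto simp: mult_G_group triangular_map_eq_iff mult.commute)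
    then show ?thesis
      using bd[OF t] g by (metis G.inv_closed G.inv_solve_left G.m_assoc G.m_closed)
  qed
  moreover have "bd (PGL m n) \<in> hom Cstar ?G"
    unfolding hom_def
  proof (intro CollectI conjI ballI)
    show "bd (PGL m n) \<in> carrier Cstar \<rightarrow> carrier ?G" using bd by (simp add: simps)
    fix s t assume "s \<in> carrier Cstar" "t \<in> carrier Cstar"
    then show "bd (PGL m n) (s \<otimes>\<^bsub>Cstar\<^esub> t) = bd (PGL m n) s \<otimes>\<^bsub>?G\<^esub> bd (PGL m n) t"
      using k t0 by (simp add: simps mult_G_group power_mult_distrib Cstar_def)
  qed
  moreover have "x = inv\<^bsub>Cstar\<^esub> y \<otimes>\<^bsub>Cstar\<^esub> x \<otimes>\<^bsub>Cstar\<^esub> y"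
    if x: "x \<in> carrier Cstar" and y: "y \<in> carrier Cstar" for x y
  proof -
    have "x \<otimes>\<^bsub>Cstar\<^esub> y = y \<otimes>\<^bsub>Cstar\<^esub> x" by (simp add: Cstar_def)
    then show ?thesis using x y by (metis C.inv_closed C.inv_solve_left C.m_assoc C.m_closed)
  qed
  ultimately show ?thesis
    unfolding crossed_module_def simps(1-3)
    by (intro conjI ballI G.is_group C.is_group) (simp_all add: simps hom_def)
qed

text \<open>
  This is exactness of \<open>t \<mapsto> (t^m, t^n)\<close>, \<open>(a, b) \<mapsto> a^n' / b^m'\<close> in the middle, where
  \<open>m = d m'\<close> and \<open>n = d n'\<close>.  By the relation \<open>n' u = m' v + 1\<close> the number \<open>s = b^u / a^v\<close>
  satisfies \<open>s^m' = a\<close> and \<open>s^n' = b\<close>; a \<open>d\<close>-th root of \<open>s\<close> is the required \<open>t\<close>.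
\<close>

lemma common_root:
  fixes a b :: complex
  assumes d: "0 < d" and uv: "n' * u = m' * v + 1" and ab: "a \<noteq> 0" "b \<noteq> 0" "a ^ n' = b ^ m'"
  obtains t where "t \<noteq> 0" "a = t ^ (d * m')" "b = t ^ (d * n')"
proof -
  define s where "s = b ^ u / a ^ v"
  have "s ^ m' * a ^ (m' * v) = b ^ (m' * u)"
    using ab by (simp add: s_def power_divide mult.commute flip: power_mult)
  also have "\<dots> = a ^ (n' * u)" unfolding power_mult ab(3) ..
  also have "\<dots> = a * a ^ (m' * v)" using uv by simp
  finally have sm: "s ^ m' = a" using ab by simp
  have "s ^ n' * b ^ (m' * v) = s ^ n' * a ^ (n' * v)" unfolding power_mult ab(3) ..
  also have "\<dots> = b ^ (n' * u)"
    using ab by (simp add: s_def power_divide mult.commute flip: power_mult)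
  also have "\<dots> = b * b ^ (m' * v)" using uv by simp
  finally have sn: "s ^ n' = b" using ab by simp
  obtain t where t: "t ^ d = s" using complex_root_exists[OF d] .
  have "s \<noteq> 0" using ab by (simp add: s_def)
  then have "t \<noteq> 0" using t d by auto
  then show thesis using that[of t] sm sn t by (simp add: power_mult)
qed

text \<open>
  Here the automorphisms are the diagonal maps \<open>(a x, b y)\<close>, and \<open>a^n' / b^m'\<close> is a monomial
  that equals \<open>1\<close> on all pairs \<open>(t^m, t^n)\<close>.  A Bezout relation \<open>n' u = m' v + 1\<close> gives its right
  inverse \<open>z \<mapsto> (z^u, z^v)\<close>.
\<close>

lemma PGL_pi1_not_dvd:
  assumes mn: "0 < m" "m < n" and ndvd: "\<not> m dvd n"
  shows "split_2group (PGL m n)" and "pi1 (PGL m n) \<cong> Cstar"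
proof -
  define d m' n' where "d = gcd m n" and "m' = m div d" and "n' = n div d"
  have d: "0 < d" "m = d * m'" "n = d * n'" using mn by (auto simp: d_def m'_def n'_def)
  have n': "n' \<noteq> 0" using d mn by auto
  have "coprime n' m'"
    unfolding m'_def n'_def d_def using mn by (subst coprime_commute, intro div_gcd_coprime) simp
  then obtain u v where uv: "n' * u = m' * v + 1"
    using bezout_nat[OF n', of m'] by (auto simp: coprime_iff_gcd_eq_1)
  let ?G = "G_group m n" and ?k = "n div m"
  have k: "0 < ?k" using mn by (simp add: div_greater_zero_iff)
  have carr: "carrier ?G = {triangular_map ?k a b 0 | a b. a \<noteq> 0 \<and> b \<noteq> 0}"
    unfolding carrier_G_group equivariant_automorphisms_eq[OF mn] using ndvd by blast
  note simps = PGL_simps(1-3) PGL_simps(4)[of _ _ _ ?k]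
  define q where "q = (\<lambda>f :: complex \<times> complex \<Rightarrow> complex \<times> complex. fst (f (1, 0)) ^ n' / snd (f (0, 1)) ^ m')"
  have q: "q (triangular_map ?k a b c) = a ^ n' / b ^ m'" for a b c
    by (simp add: q_def triangular_map_coordinates[OF k])
  define \<sigma> where "\<sigma> = (\<lambda>z :: complex. triangular_map ?k (z ^ u) (z ^ v) 0)"
  have qhom: "q \<in> hom (grp1 (PGL m n)) Cstar"
    unfolding hom_def simps
  proof (intro CollectI conjI ballI)
    show "q \<in> carrier ?G \<rightarrow> carrier Cstar" by (auto simp: carr q Cstar_def)
    fix f g assume "f \<in> carrier ?G" "g \<in> carrier ?G"
    then obtain a b a' b' where *: "f = triangular_map ?k a b 0" "a \<noteq> 0" "b \<noteq> 0"
      "g = triangular_map ?k a' b' 0" "a' \<noteq> 0" "b' \<noteq> 0" unfolding carr by blast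
    then show "q (f \<otimes>\<^bsub>?G\<^esub> g) = q f \<otimes>\<^bsub>Cstar\<^esub> q g"
      using k by (simp add: mult_G_group q power_mult_distrib Cstar_def)
  qed
  have ker: "kernel (grp1 (PGL m n)) Cstar q = bd (PGL m n) ` carrier (grp2 (PGL m n))"
  proof (intro equalityI subsetI)
    fix f assume "f \<in> kernel (grp1 (PGL m n)) Cstar q"
    then have f: "f \<in> carrier ?G" "q f = 1" by (auto simp: kernel_def simps Cstar_def)
    then obtain a b where ab: "f = triangular_map ?k a b 0" "a \<noteq> 0" "b \<noteq> 0" unfolding carr by blast
    then have "a ^ n' = b ^ m'" using f(2) by (simp add: q)
    then obtain t where "t \<noteq> 0" "a = t ^ m" "b = t ^ n"
      using common_root[OF d(1) uv ab(2,3)] d by metis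
    then show "f \<in> bd (PGL m n) ` carrier (grp2 (PGL m n))"
      unfolding simps ab(1) by (intro image_eqI[of _ _ t]) (auto simp: simps Cstar_def)
  next
    fix f assume "f \<in> bd (PGL m n) ` carrier (grp2 (PGL m n))"
    then obtain t where t: "t \<noteq> 0" "f = triangular_map ?k (t ^ m) (t ^ n) 0"
      by (auto simp: simps Cstar_def)
    have "t ^ m \<noteq> 0" "t ^ n \<noteq> 0" using t(1) by auto
    then have "f \<in> carrier ?G" unfolding carr t(2) by blast
    moreover have "(t ^ m) ^ n' = (t ^ n) ^ m'"
      unfolding d(2,3) by (simp add: mult.commute mult.left_commute flip: power_mult)
    then have "q f = 1" using t by (simp add: q)
    ultimately show "f \<in> kernel (grp1 (PGL m n)) Cstar q" by (simp add: kernel_def simps Cstar_def)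
  qed
  have \<sigma>hom: "\<sigma> \<in> hom Cstar (grp1 (PGL m n))"
    unfolding hom_def simps
  proof (intro CollectI conjI ballI)
    show "\<sigma> \<in> carrier Cstar \<rightarrow> carrier ?G"
    proof
      fix z assume "z \<in> carrier Cstar"
      then have "z ^ u \<noteq> 0" "z ^ v \<noteq> 0" by (auto simp: Cstar_def)
      then show "\<sigma> z \<in> carrier ?G" unfolding carr \<sigma>_def by blast
    qed
    fix y z assume "y \<in> carrier Cstar" "z \<in> carrier Cstar"
    then show "\<sigma> (y \<otimes>\<^bsub>Cstar\<^esub> z) = \<sigma> y \<otimes>\<^bsub>?G\<^esub> \<sigma> z"
      using k by (simp add: \<sigma>_def mult_G_group power_mult_distrib Cstar_def)
  qed
  have "q (\<sigma> z) = z" if "z \<in> carrier Cstar" for z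
  proof -
    have "(z ^ u) ^ n' = z * (z ^ v) ^ m'"
      using uv by (metis mult.commute power_add power_mult power_one_right)
    then show ?thesis using that by (simp add: \<sigma>_def q Cstar_def)
  qed
  with split_2group_of_split_epi[OF crossed_module_PGL[OF mn] group_Cstar qhom ker \<sigma>hom]
  show "split_2group (PGL m n)" "pi1 (PGL m n) \<cong> Cstar" by simp_all
qed

text \<open>
  Acting by \<open>t\<close> with \<open>t^m = 1 / a\<close> normalises \<open>a\<close> to \<open>1\<close>, and then \<open>b\<close> and \<open>c\<close> become
  \<open>b / a^k\<close> and \<open>c / a^k\<close> with \<open>k = n / m\<close>.  The maps with \<open>a = 1\<close> form a subgroup, which is
  the required complement; composing them gives \<open>(b, c) (b', c') = (b b', c + b c')\<close>, the
  multiplication of the semidirect product.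
\<close>

lemma PGL_pi1_dvd:
  assumes mn: "0 < m" "m < n" and dvd: "m dvd n"
  shows "split_2group (PGL m n)" and "pi1 (PGL m n) \<cong> semidirect Cstar Cplus (*)"
proof -
  let ?G = "G_group m n" and ?k = "n div m" and ?Q = "semidirect Cstar Cplus (*)"
  have k: "0 < ?k" using mn by (simp add: div_greater_zero_iff)
  have n: "n = m * ?k" using dvd by simp
  have carr: "carrier ?G = {triangular_map ?k a b c | a b c. a \<noteq> 0 \<and> b \<noteq> 0}"
    unfolding carrier_G_group equivariant_automorphisms_eq[OF mn] using dvd by blast
  note simps = PGL_simps(1-3) PGL_simps(4)[of _ _ _ ?k]
  note Q = semidirect_def Cstar_def Cplus_def
  define q where "q = (\<lambda>f :: complex \<times> complex \<Rightarrow> complex \<times> complex.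
    (snd (f (0, 1)) / fst (f (1, 0)) ^ ?k, snd (f (1, 0)) / fst (f (1, 0)) ^ ?k))"
  have q: "q (triangular_map ?k a b c) = (b / a ^ ?k, c / a ^ ?k)" for a b c
    by (simp add: q_def triangular_map_coordinates[OF k])
  define \<sigma> where "\<sigma> = (\<lambda>(b, c). triangular_map ?k 1 b c)"
  have qhom: "q \<in> hom (grp1 (PGL m n)) ?Q"
    unfolding hom_def simps
  proof (intro CollectI conjI ballI)
    show "q \<in> carrier ?G \<rightarrow> carrier ?Q" by (auto simp: carr q Q)
    fix f g assume "f \<in> carrier ?G" "g \<in> carrier ?G"
    then obtain a b c a' b' c' where *: "f = triangular_map ?k a b c" "a \<noteq> 0" "b \<noteq> 0"
      "g = triangular_map ?k a' b' c'" "a' \<noteq> 0" "b' \<noteq> 0" unfolding carr by blast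
    then show "q (f \<otimes>\<^bsub>?G\<^esub> g) = q f \<otimes>\<^bsub>?Q\<^esub> q g"
      using k by (simp add: mult_G_group q power_mult_distrib Q add_divide_distrib)
  qed
  have ker: "kernel (grp1 (PGL m n)) ?Q q = bd (PGL m n) ` carrier (grp2 (PGL m n))"
  proof (intro equalityI subsetI)
    fix f assume "f \<in> kernel (grp1 (PGL m n)) ?Q q"
    then have f: "f \<in> carrier ?G" "q f = (1, 0)" by (auto simp: kernel_def simps Q)
    then obtain a b c where abc: "f = triangular_map ?k a b c" "a \<noteq> 0" "b \<noteq> 0" unfolding carr by blast
    then have b: "b = a ^ ?k" and c: "c = 0" using f(2) by (auto simp: q)
    obtain t where t: "t ^ m = a" using complex_root_exists[OF mn(1)] .
    then have "t \<noteq> 0" using abc(2) mn(1) by auto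
    moreover have "t ^ n = b" using n by (metis b power_mult t)
    ultimately show "f \<in> bd (PGL m n) ` carrier (grp2 (PGL m n))"
      unfolding simps abc(1) by (intro image_eqI[of _ _ t]) (auto simp: simps Cstar_def c t)
  next
    fix f assume "f \<in> bd (PGL m n) ` carrier (grp2 (PGL m n))"
    then obtain t where t: "t \<noteq> 0" "f = triangular_map ?k (t ^ m) (t ^ n) 0"
      by (auto simp: simps Cstar_def)
    have "t ^ m \<noteq> 0" "t ^ n \<noteq> 0" using t(1) by auto
    then have "f \<in> carrier ?G" unfolding carr t(2) by blast
    moreover have "(t ^ m) ^ ?k = t ^ n" using n by (metis power_mult)
    then have "q f = (1, 0)" using t by (simp add: q)
    ultimately show "f \<in> kernel (grp1 (PGL m n)) ?Q q" by (simp add: kernel_def simps Q)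
  qed
  have \<sigma>hom: "\<sigma> \<in> hom ?Q (grp1 (PGL m n))"
    unfolding hom_def simps
  proof (intro CollectI conjI ballI)
    show "\<sigma> \<in> carrier ?Q \<rightarrow> carrier ?G"
    proof
      fix z assume "z \<in> carrier ?Q"
      then obtain b c where "z = (b, c)" "b \<noteq> 0" by (auto simp: Q)
      then show "\<sigma> z \<in> carrier ?G" unfolding carr \<sigma>_def using one_neq_zero by fastforce
    qed
    fix y z assume "y \<in> carrier ?Q" "z \<in> carrier ?Q"
    then show "\<sigma> (y \<otimes>\<^bsub>?Q\<^esub> z) = \<sigma> y \<otimes>\<^bsub>?G\<^esub> \<sigma> z"
      using k by (auto simp: \<sigma>_def mult_G_group Q add.commute)
  qed
  have "q (\<sigma> z) = z" for z by (cases z) (simp add: \<sigma>_def q)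
  with split_2group_of_split_epi[OF crossed_module_PGL[OF mn] group_semidirect_Cstar_Cplus qhom ker \<sigma>hom]
  show "split_2group (PGL m n)" "pi1 (PGL m n) \<cong> ?Q" by simp_all
qed

lemma power_gcd_eq_1_iff:
  fixes t :: complex
  assumes "0 < m"
  shows "t ^ m = 1 \<and> t ^ n = 1 \<longleftrightarrow> t ^ gcd m n = 1"
proof
  assume t: "t ^ m = 1 \<and> t ^ n = 1"
  obtain x y where xy: "m * x = n * y + gcd m n" using bezout_nat[of m n] assms by auto
  have "1 = t ^ (m * x)" using t by (simp add: power_mult)
  also have "\<dots> = t ^ gcd m n" unfolding xy power_add using t by (simp add: power_mult)
  finally show "t ^ gcd m n = 1" ..
next
  assume t: "t ^ gcd m n = 1"
  have "t ^ i = 1" if "gcd m n dvd i" for i using that t by (auto elim!: dvdE simp: power_mult)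
  then show "t ^ m = 1 \<and> t ^ n = 1" by simp
qed

lemma PGL_pi2:
  assumes mn: "0 < m" "m < n" and d: "d = gcd m n"
  shows "pi2 (PGL m n) \<cong> integer_mod_group d"
proof -
  let ?k = "n div m"
  have k: "0 < ?k" using mn by (simp add: div_greater_zero_iff)
  have d0: "0 < d" using mn d by simp
  have "carrier (pi2 (PGL m n)) = {t. t \<noteq> 0 \<and> t ^ m = 1 \<and> t ^ n = 1}"
    unfolding carrier_pi2 PGL_simps(1,2) PGL_simps(4)[of _ _ _ ?k] one_G_group[of _ _ ?k] triangular_map_eq_iff[OF k]
    by (auto simp: Cstar_def)
  also have "\<dots> = {t. t ^ d = 1}"
    using power_gcd_eq_1_iff[OF mn(1)] d d0 by (auto simp: power_0_left)
  finally have carr: "carrier (pi2 (PGL m n)) = {t. t ^ d = 1}" .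
  define e where "e = (\<lambda>j :: int. cis (2 * pi * real_of_int j / real d))"
  have e_add: "e (i + j) = e i * e j" for i j
    by (simp add: e_def cis_mult distrib_left add_divide_distrib)
  have e_mod: "e (j mod int d) = e j" for j
  proof -
    have "e (int d * (j div int d)) = cis (2 * pi * real_of_int (j div int d))"
      unfolding e_def by (rule arg_cong[where f = cis]) (use d0 in simp)
    also have "\<dots> = 1" by (rule cis_multiple_2pi) simp
    finally show ?thesis
      using e_add[of "int d * (j div int d)" "j mod int d"] by simp
  qed
  have "bij_betw nat {0..<int d} {..<d}"
    by (rule bij_betwI[where g = int]) auto
  from bij_betw_trans[OF this bij_betw_roots_unity[OF d0]]
  have "bij_betw e {0..<int d} {t. t ^ d = 1}"
    by (rule iffD1[OF bij_betw_cong, rotated]) (simp add: e_def)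
  then have bij: "bij_betw e (carrier (integer_mod_group d)) (carrier (pi2 (PGL m n)))"
    using d0 by (simp add: carrier_integer_mod_group carr)
  have "e \<in> iso (integer_mod_group d) (pi2 (PGL m n))"
    unfolding iso_def hom_def
    using bij bij_betwE[OF bij] by (auto simp: e_mod e_add pi2_def PGL_simps(2) Cstar_def)
  from group.iso_set_sym[OF group_integer_mod_group this] show ?thesis by (rule is_isoI)
qed

theorem proposition8p5:
  fixes m n d :: nat
  assumes "0 < m" and "m < n" and "d = gcd m n"
  shows "split_2group (PGL m n) \<and>
    (\<forall>H :: ('a, 'b) xmod. split_2group H \<longrightarrow>
       (equivalent_2groups H (PGL m n) \<longleftrightarrow> same_homotopy_groups H (PGL m n))) \<and>
    (\<not> m dvd n \<longrightarrow> pi1 (PGL m n) \<cong> Cstar) \<and>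
    (m dvd n \<longrightarrow> pi1 (PGL m n) \<cong> semidirect Cstar Cplus (\<lambda>a z. a * z)) \<and>
    pi2 (PGL m n) \<cong> integer_mod_group d"
proof -
  have "split_2group (PGL m n)"
    using PGL_pi1_not_dvd(1) PGL_pi1_dvd(1) assms(1,2) by blast
  then show ?thesis
    using split_2groups_equivalent_iff PGL_pi1_not_dvd(2) PGL_pi1_dvd(2) PGL_pi2 assms by blast
qed

end
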